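(* Let $\varphi$ be a holomorphic self-map of the unit ball $\mathbb{B}_n\subset\mathbb{C}^n$ and let $\psi\in H(\mathbb{B}_n)$. Let $W_{\psi,\varphi}f=\psi\,(f\circ\varphi)$. Then $W_{\psi,\varphi}:H^\infty(\mathbb{B}_n)\to\mathcal{B}(\mathbb{B}_n)$ is compact if and only if it is bounded, $$\lim_{\|\varphi(z)\|\to1}Q_\psi(z)=0,\quad\text{and}\quad\lim_{\|\varphi(z)\|\to1}|\psi(z)|\,\theta_\varphi(z)=0.$$
   Context: $\mathbb{B}_n=\{z\in\mathbb{C}^n:\|z\|<1\}$ with the Euclidean norm and $\langle u,v\rangle=\sum_j u_j\overline{v_j}$. $H(\mathbb{B}_n)$ is the set of holomorphic functions $\mathbb{B}_n\to\mathbb{C}$, and $H^\infty(\mathbb{B}_n)$ is the space of bounded ones with the supremum norm $\|\cdot\|_\infty$. Bergman metric: $H_z(u,\overline{v})=\frac{n+1}{2}\cdot\frac{(1-\|z\|^2)\langle u,v\rangle+\langle u,z\rangle\langle z,v\rangle}{(1-\|z\|^2)^2}$. For $f\in H(\mathbb{B}_n)$, let $Q_f(z)=\sup_{u\in\mathbb{C}^n\setminus\{0\}}\frac{\left|\sum_{k=1}^n\frac{\partial f}{\partial z_k}(z)u_k\right|}{H_z(u,\overline{u})^{1/2}}$ and $\beta_f=\sup_{z\in\mathbb{B}_n}Q_f(z)$. The Bloch space $\mathcal{B}(\mathbb{B}_n)=\{f\in H(\mathbb{B}_n):\beta_f<\infty\}$ has norm $\|f\|_{\mathcal{B}}=|f(0)|+\beta_f$.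 $\theta_\varphi(z)=\sup\{Q_{f\circ\varphi}(z):f\in H^\infty(\mathbb{B}_n),\ \|f\|_\infty\le1\}$. $\lim_{\|\varphi(z)\|\to1}F(z)=0$ means: for each $\varepsilon>0$ there is $r\in(0,1)$ such that $|F(z)|<\varepsilon$ for all $z\in\mathbb{B}_n$ with $\|\varphi(z)\|>r$ (vacuously true if $\sup_z\|\varphi(z)\|<1$). *)

theory Defs
  imports "HOL-Analysis.Analysis"
begin

text \<open>
  The space of \<open>n\<close> complex variables is \<open>complex^'n\<close>, whose \<^const>\<open>norm\<close> is the Euclidean norm;
  the unit ball is \<open>ball 0 1\<close>.  The library inner product on \<open>complex^'n\<close> is the real one, so the
  Hermitian product is defined here.  Complex scalar multiplication of vectors is \<open>*s\<close>.
\<close>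

definition herm :: "complex^'n \<Rightarrow> complex^'n \<Rightarrow> complex" where
  "herm u v = (\<Sum>j\<in>UNIV. u $ j * cnj (v $ j))"

text \<open>Holomorphy as complex Frechet differentiability: the real derivative is complex linear.\<close>

definition holo_on :: "(complex^'n \<Rightarrow> complex) \<Rightarrow> (complex^'n) set \<Rightarrow> bool" where
  "holo_on f S \<longleftrightarrow>
     (\<forall>z\<in>S. \<exists>D. (f has_derivative D) (at z) \<and> (\<forall>c v. D (c *s v) = c * D v))"

definition holo_self_map :: "(complex^'n \<Rightarrow> complex^'n) \<Rightarrow> bool" where
  "holo_self_map \<phi> \<longleftrightarrow>
     (\<forall>j. holo_on (\<lambda>z. \<phi> z $ j) (ball 0 1)) \<and> \<phi> ` ball 0 1 \<subseteq> ball 0 1"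

definition cpartial :: "(complex^'n \<Rightarrow> complex) \<Rightarrow> 'n \<Rightarrow> complex^'n \<Rightarrow> complex" where
  "cpartial f k z = deriv (\<lambda>t. f (z + t *s axis k 1)) 0"

text \<open>\<open>bergman z u v\<close> stands for \<open>H_z(u, cnj v)\<close>.\<close>

definition bergman :: "complex^'n \<Rightarrow> complex^'n \<Rightarrow> complex^'n \<Rightarrow> complex" where
  "bergman z u v =
     of_real ((real CARD('n) + 1) / 2) *
     ((of_real (1 - (norm z)\<^sup>2) * herm u v + herm u z * herm z v) /
      of_real ((1 - (norm z)\<^sup>2)\<^sup>2))"

text \<open>
  Suprema are taken in \<^typ>\<open>ereal\<close>, so that finiteness is a genuine condition.
  \<open>bergman z u u\<close> is real, so taking its real part loses nothing.
\<close>

definition Q :: "(complex^'n \<Rightarrow> complex) \<Rightarrow> complex^'n \<Rightarrow> ereal" where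
  "Q f z = (SUP u\<in>-{0}.
     ereal (cmod (\<Sum>k\<in>UNIV. cpartial f k z * u $ k) / sqrt (Re (bergman z u u))))"

definition bloch_seminorm :: "(complex^'n \<Rightarrow> complex) \<Rightarrow> ereal" where
  "bloch_seminorm f = (SUP z\<in>ball 0 1. Q f z)"

definition bloch_norm :: "(complex^'n \<Rightarrow> complex) \<Rightarrow> ereal" where
  "bloch_norm f = ereal (cmod (f 0)) + bloch_seminorm f"

text \<open>
  Functions on the ball are represented by functions that are \<^const>\<open>undefined\<close> outside it
  (\<^const>\<open>extensional\<close>), so that equality in the spaces below is equality on the ball.
\<close>

definition H_ball :: "(complex^'n \<Rightarrow> complex) set" where
  "H_ball = {f \<in> extensional (ball 0 1). holo_on f (ball 0 1)}"

definition H_inf :: "(complex^'n \<Rightarrow> complex) set" where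
  "H_inf = {f \<in> H_ball. bounded (f ` ball 0 1)}"

definition sup_norm :: "(complex^'n \<Rightarrow> complex) \<Rightarrow> real" where
  "sup_norm f = (SUP z\<in>ball 0 1. cmod (f z))"

definition bloch_space :: "(complex^'n \<Rightarrow> complex) set" where
  "bloch_space = {f \<in> H_ball. bloch_seminorm f < \<infinity>}"

text \<open>The distance is \<open>bloch_norm (f - g)\<close>; the value 0 off the space is never used and only serves the
  locale \<^locale>\<open>Metric_space\<close>, which demands symmetry on the whole type.\<close>

definition bloch_dist :: "(complex^'n \<Rightarrow> complex) \<Rightarrow> (complex^'n \<Rightarrow> complex) \<Rightarrow> real" where
  "bloch_dist f g =
     (if f \<in> bloch_space \<and> g \<in> bloch_space
      then real_of_ereal (bloch_norm (\<lambda>z. f z - g z)) else 0)"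

definition bloch_topology :: "(complex^'n \<Rightarrow> complex) topology" where
  "bloch_topology = Metric_space.mtopology bloch_space bloch_dist"

definition \<theta> :: "(complex^'n \<Rightarrow> complex^'n) \<Rightarrow> complex^'n \<Rightarrow> ereal" where
  "\<theta> \<phi> z = (SUP f\<in>{f \<in> H_inf. sup_norm f \<le> 1}. Q (f \<circ> \<phi>) z)"

definition wcomp ::
  "(complex^'n \<Rightarrow> complex) \<Rightarrow> (complex^'n \<Rightarrow> complex^'n) \<Rightarrow> (complex^'n \<Rightarrow> complex) \<Rightarrow>
   complex^'n \<Rightarrow> complex" where
  "wcomp \<psi> \<phi> f = (\<lambda>z\<in>ball 0 1. \<psi> z * f (\<phi> z))"

text \<open>For operators from \<^const>\<open>H_inf\<close> to \<^const>\<open>bloch_space\<close>; mapping into the Bloch space is part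
  of both notions.\<close>

definition bounded_Hinf_bloch ::
  "((complex^'n \<Rightarrow> complex) \<Rightarrow> (complex^'n \<Rightarrow> complex)) \<Rightarrow> bool" where
  "bounded_Hinf_bloch T \<longleftrightarrow> T ` H_inf \<subseteq> bloch_space \<and>
     (\<exists>C::real. \<forall>f\<in>H_inf. bloch_norm (T f) \<le> ereal (C * sup_norm f))"

definition compact_Hinf_bloch ::
  "((complex^'n \<Rightarrow> complex) \<Rightarrow> (complex^'n \<Rightarrow> complex)) \<Rightarrow> bool" where
  "compact_Hinf_bloch T \<longleftrightarrow> T ` H_inf \<subseteq> bloch_space \<and>
     (\<forall>S\<subseteq>H_inf. (\<exists>C. \<forall>f\<in>S. sup_norm f \<le> C) \<longrightarrow>
        compactin bloch_topology (bloch_topology closure_of (T ` S)))"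

text \<open>\<open>vanishes_at_boundary \<phi> F\<close>: the limit of \<open>F(z)\<close> as \<open>norm (\<phi> z)\<close> tends to 1 is 0,
  vacuously so if \<open>\<phi>\<close> stays away from the sphere.\<close>

definition vanishes_at_boundary ::
  "(complex^'n \<Rightarrow> complex^'n) \<Rightarrow> (complex^'n \<Rightarrow> ereal) \<Rightarrow> bool" where
  "vanishes_at_boundary \<phi> F \<longleftrightarrow>
     (\<forall>\<epsilon>>0. \<exists>r\<in>{0<..<1}. \<forall>z\<in>ball 0 1. norm (\<phi> z) > r \<longrightarrow> \<bar>F z\<bar> < ereal \<epsilon>)"

text \<open>\<^const>\<open>bloch_dist\<close> is a metric, so \<^const>\<open>bloch_topology\<close> is the norm topology.\<close>

lemma bergman_diag_pos: "0 < Re (bergman z u u)"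
  if "z \<in> ball 0 1" "u \<noteq> 0" for z :: "complex^'n"
proof -
  have 1: "herm u u = of_real ((norm u)\<^sup>2)" 
    by (simp add: herm_def norm_vec_def L2_set_def sum_nonneg complex_norm_square[symmetric])
  have "herm z u = cnj (herm u z)" by (simp add: herm_def mult.commute)
  then have 2: "herm u z * herm z u = of_real ((cmod (herm u z))\<^sup>2)"
    by (simp only: complex_norm_square)
  have n: "(norm z)\<^sup>2 < 1" using that by (simp add: power_less_one_iff abs_square_less_1)
  have "bergman z u u = of_real ((real CARD('n) + 1) / 2 *
     (((1 - (norm z)\<^sup>2) * (norm u)\<^sup>2 + (cmod (herm u z))\<^sup>2) / (1 - (norm z)\<^sup>2)\<^sup>2))"
    unfolding bergman_def 1 2 by simp
  moreover have "0 < (1 - (norm z)\<^sup>2) * (norm u)\<^sup>2 + (cmod (herm u z))\<^sup>2"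
    using n that by (intro add_pos_nonneg mult_pos_pos) auto
  ultimately show ?thesis using n by (auto intro!: divide_pos_pos mult_pos_pos)
qed

lemma Q_nonneg: "0 \<le> Q f z" if "z \<in> ball 0 1" for z :: "complex^'n"
proof -
  have "0 < Re (bergman z 1 1)" by (rule bergman_diag_pos[OF that]) (simp add: vec_eq_iff)
  then have "0 \<le> ereal (cmod (\<Sum>k\<in>UNIV. cpartial f k z * 1 $ k) / sqrt (Re (bergman z 1 1)))"
    by simp
  also have "\<dots> \<le> Q f z" unfolding Q_def
    by (rule SUP_upper) (simp add: vec_eq_iff)
  finally show ?thesis .
qed

lemma cpartial_eq:
  fixes z :: "complex^'n"
  assumes "(f has_derivative D) (at z)" "\<And>c v. D (c *s v) = c * D v"
  shows "((\<lambda>t. f (z + t *s axis k 1)) has_field_derivative D (axis k 1)) (at 0)"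
    and "cpartial f k z = D (axis k 1)"
proof -
  have bl: "bounded_linear (\<lambda>t. t *s (axis k 1 :: complex^'n))"
    by (rule linear_conv_bounded_linear[THEN iffD1], rule linearI) 
       (auto simp: vec_eq_iff algebra_simps)
  have g: "((\<lambda>t. z + t *s axis k 1) has_derivative (\<lambda>t. t *s axis k 1)) (at 0)"
    using has_derivative_add[OF has_derivative_const bounded_linear.has_derivative[OF bl has_derivative_ident]]
    by simp
  have f: "(f has_derivative D) (at (z + 0 *s axis k 1))" using assms(1) by simp
  have "((\<lambda>t. f (z + t *s axis k 1)) has_derivative (\<lambda>t. D (t *s axis k 1))) (at 0)"
    using has_derivative_compose[OF g f] by simp
  moreover have "(\<lambda>t. D (t *s axis k 1)) = (*) (D (axis k 1))"
    by (auto simp: assms(2) mult.commute)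
  ultimately show *: "((\<lambda>t. f (z + t *s axis k 1)) has_field_derivative D (axis k 1)) (at 0)"
    by (simp add: has_field_derivative_def)
  show "cpartial f k z = D (axis k 1)"
    unfolding cpartial_def by (rule DERIV_imp_deriv[OF *])
qed

lemma deriv_eq_sum_cpartial:
  fixes z :: "complex^'n"
  assumes "(f has_derivative D) (at z)" "\<And>c v. D (c *s v) = c * D v"
  shows "D u = (\<Sum>k\<in>UNIV. cpartial f k z * u $ k)"
proof -
  interpret bounded_linear D using assms(1) by (rule has_derivative_bounded_linear)
  have "D u = D (\<Sum>k\<in>UNIV. u $ k *s axis k 1)" by (simp add: basis_expansion)
  also have "\<dots> = (\<Sum>k\<in>UNIV. u $ k * D (axis k 1))" by (simp add: sum assms(2))
  finally show ?thesis by (simp add: cpartial_eq(2)[OF assms] mult.commute)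
qed

lemma holo_on_diff: "holo_on (\<lambda>z. f z - g z) S" if f: "holo_on f S" and g: "holo_on g S"
  unfolding holo_on_def
proof
  fix z assume "z \<in> S"
  obtain D where "(f has_derivative D) (at z)" "\<forall>c v. D (c *s v) = c * D v"
    using f \<open>z \<in> S\<close> unfolding holo_on_def by blast
  moreover obtain E where "(g has_derivative E) (at z)" "\<forall>c v. E (c *s v) = c * E v"
    using g \<open>z \<in> S\<close> unfolding holo_on_def by blast
  ultimately show "\<exists>D. ((\<lambda>z. f z - g z) has_derivative D) (at z) \<and> (\<forall>c v. D (c *s v) = c * D v)"
    by (intro exI[of _ "\<lambda>v. D v - E v"]) (auto intro: has_derivative_diff simp: algebra_simps)
qed

lemma cpartial_diff:
  assumes "holo_on f S" "holo_on g S" "z \<in> S"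
  shows "cpartial (\<lambda>z. f z - g z) k z = cpartial f k z - cpartial g k z"
proof -
  obtain D E where D: "(f has_derivative D) (at z)" "\<And>c v. D (c *s v) = c * D v"
     and E: "(g has_derivative E) (at z)" "\<And>c v. E (c *s v) = c * E v"
    using assms unfolding holo_on_def by meson
  have "cpartial (\<lambda>z. f z - g z) k z = D (axis k 1) - E (axis k 1)"
    by (rule cpartial_eq(2)[OF has_derivative_diff[OF D(1) E(1)]]) (auto simp: D E algebra_simps)
  then show ?thesis by (simp add: cpartial_eq(2)[OF D] cpartial_eq(2)[OF E])
qed

lemma Q_diff_commute:
  assumes "holo_on f S" "holo_on g S" "z \<in> S"
  shows "Q (\<lambda>z. f z - g z) z = Q (\<lambda>z. g z - f z) z"
proof -
  have "cmod (\<Sum>k\<in>UNIV. cpartial (\<lambda>z. f z - g z) k z * u $ k) =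
        cmod (\<Sum>k\<in>UNIV. cpartial (\<lambda>z. g z - f z) k z * u $ k)" for u
    unfolding cpartial_diff[OF assms] cpartial_diff[OF assms(2,1,3)]
    by (simp add: left_diff_distrib sum_subtractf norm_minus_commute)
  then show ?thesis unfolding Q_def by simp
qed

lemma Q_diff_triangle:
  fixes z :: "complex^'n"
  assumes "holo_on f (ball 0 1)" "holo_on g (ball 0 1)" "z \<in> ball 0 1"
  shows "Q (\<lambda>z. f z - g z) z \<le> Q f z + Q g z"
  unfolding Q_def[of "\<lambda>z. f z - g z"]
proof (rule SUP_least)
  fix u :: "complex^'n" assume u: "u \<in> - {0}"
  let ?F = "\<lambda>h. cmod (\<Sum>k\<in>UNIV. cpartial h k z * u $ k) / sqrt (Re (bergman z u u))"
  have "cmod (\<Sum>k\<in>UNIV. cpartial (\<lambda>z. f z - g z) k z * u $ k) \<le>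
     cmod (\<Sum>k\<in>UNIV. cpartial f k z * u $ k) + cmod (\<Sum>k\<in>UNIV. cpartial g k z * u $ k)"
    unfolding cpartial_diff[OF assms]
    by (simp add: left_diff_distrib sum_subtractf norm_triangle_ineq4)
  moreover have "0 < Re (bergman z u u)" using u assms(3) by (auto intro: bergman_diag_pos)
  ultimately have "?F (\<lambda>z. f z - g z) \<le> ?F f + ?F g"
    by (simp add: add_divide_distrib[symmetric] divide_right_mono)
  then have "ereal (?F (\<lambda>z. f z - g z)) \<le> ereal (?F f) + ereal (?F g)" by simp
  also have "\<dots> \<le> Q f z + Q g z"
    unfolding Q_def using u by (intro add_mono SUP_upper)
  finally show "ereal (?F (\<lambda>z. f z - g z)) \<le> Q f z + Q g z" .
qed

lemma bloch_seminorm_nonneg: "0 \<le> bloch_seminorm f"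
proof -
  have "0 \<le> Q f 0" by (rule Q_nonneg) simp
  also have "\<dots> \<le> bloch_seminorm f" unfolding bloch_seminorm_def by (rule SUP_upper) simp
  finally show ?thesis .
qed

lemma bloch_norm_nonneg: "0 \<le> bloch_norm f"
  unfolding bloch_norm_def using bloch_seminorm_nonneg[of f] by (intro add_nonneg_nonneg) auto

lemma bloch_norm_diff_triangle:
  fixes f g :: "complex^'n \<Rightarrow> complex"
  assumes "holo_on f (ball 0 1)" "holo_on g (ball 0 1)"
  shows "bloch_norm (\<lambda>z. f z - g z) \<le> bloch_norm f + bloch_norm g"
proof -
  have "bloch_seminorm (\<lambda>z. f z - g z) \<le> bloch_seminorm f + bloch_seminorm g"
    unfolding bloch_seminorm_def[of "\<lambda>z. f z - g z"]
  proof (rule SUP_least)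
    fix z :: "complex^'n" assume z: "z \<in> ball 0 1"
    have "Q (\<lambda>z. f z - g z) z \<le> Q f z + Q g z" by (rule Q_diff_triangle[OF assms z])
    also have "\<dots> \<le> bloch_seminorm f + bloch_seminorm g"
      unfolding bloch_seminorm_def using z by (intro add_mono SUP_upper)
    finally show "Q (\<lambda>z. f z - g z) z \<le> bloch_seminorm f + bloch_seminorm g" .
  qed
  moreover have "ereal (cmod (f 0 - g 0)) \<le> ereal (cmod (f 0)) + ereal (cmod (g 0))"
    by (simp add: norm_triangle_ineq4)
  ultimately have "ereal (cmod (f 0 - g 0)) + bloch_seminorm (\<lambda>z. f z - g z) \<le>
    (ereal (cmod (f 0)) + ereal (cmod (g 0))) + (bloch_seminorm f + bloch_seminorm g)"
    by (rule add_mono[rotated])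
  then show ?thesis unfolding bloch_norm_def by (simp add: ac_simps)
qed

lemma bloch_norm_diff_commute:
  assumes "holo_on f (ball 0 1)" "holo_on g (ball 0 1)"
  shows "bloch_norm (\<lambda>z. f z - g z) = bloch_norm (\<lambda>z. g z - f z)"
  unfolding bloch_norm_def bloch_seminorm_def
  using Q_diff_commute[OF assms] by (simp add: norm_minus_commute cong: SUP_cong_simp)

lemma bloch_norm_diff_finite:
  assumes "f \<in> bloch_space" "g \<in> bloch_space"
  shows "bloch_norm (\<lambda>z. f z - g z) = ereal (bloch_dist f g)"
proof -
  have "bloch_norm (\<lambda>z. f z - g z) \<le> bloch_norm f + bloch_norm g"
    using assms by (intro bloch_norm_diff_triangle) (auto simp: bloch_space_def H_ball_def)
  also have "\<dots> < \<infinity>"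
    using assms by (auto simp: bloch_space_def bloch_norm_def)
  finally show ?thesis unfolding bloch_dist_def
    using bloch_norm_nonneg[of "\<lambda>z. f z - g z"] assms by (auto simp: ereal_real)
qed

lemma bloch_norm_eq_0:
  assumes "holo_on f (ball 0 1)" "bloch_norm f = 0" "w \<in> ball 0 1"
  shows "f w = 0"
proof -
  have "ereal (cmod (f 0)) + bloch_seminorm f = 0"
    using assms(2) unfolding bloch_norm_def .
  then have "ereal (cmod (f 0)) = 0 \<and> bloch_seminorm f = 0"
    by (subst (asm) add_nonneg_eq_0_iff) (simp_all add: bloch_seminorm_nonneg)
  then have b: "bloch_seminorm f = 0" and f0: "f 0 = 0" by simp_all
  have "(f has_derivative (\<lambda>_. 0)) (at z)" if z: "z \<in> ball 0 1" for z
  proof -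
    obtain D where D: "(f has_derivative D) (at z)" "\<And>c v. D (c *s v) = c * D v"
      using assms(1) z unfolding holo_on_def by meson
    have "D u = 0" for u
    proof (cases "u = 0")
      case True
      then show ?thesis using D(2)[of 0 0] by simp
    next
      case False
      have "ereal (cmod (\<Sum>k\<in>UNIV. cpartial f k z * u $ k) / sqrt (Re (bergman z u u))) \<le> Q f z"
        unfolding Q_def using False by (intro SUP_upper) auto
      also have "\<dots> \<le> bloch_seminorm f" unfolding bloch_seminorm_def using z by (rule SUP_upper)
      finally have "cmod (D u) / sqrt (Re (bergman z u u)) \<le> 0"
        unfolding b deriv_eq_sum_cpartial[OF D, symmetric] by simp
      then show ?thesis
        using bergman_diag_pos[OF z False] by (simp add: divide_le_0_iff)
    qed
    then have "D = (\<lambda>_. 0)" by auto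
    then show ?thesis using D(1) by simp
  qed
  then have "\<And>z. z \<in> ball 0 1 \<Longrightarrow> (f has_derivative (\<lambda>_. 0)) (at z within ball 0 1)"
    by (rule has_derivative_at_withinI)
  then obtain c where c: "\<And>x. x \<in> ball 0 1 \<Longrightarrow> f x = c"
    using has_derivative_zero_constant[OF convex_ball, of 0 1 f] by blast
  have "f w = f 0" using c[OF assms(3)] c[of 0] by simp
  then show ?thesis using f0 by simp
qed

lemma Metric_space_bloch: "Metric_space bloch_space bloch_dist"
proof
  fix f g h :: "complex^'n \<Rightarrow> complex"
  show "0 \<le> bloch_dist f g" unfolding bloch_dist_def
    by (simp add: real_of_ereal_pos[OF bloch_norm_nonneg])
  show "bloch_dist f g = bloch_dist g f" 
    using bloch_norm_diff_commute[of f g] 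
    by (auto simp: bloch_dist_def bloch_space_def H_ball_def)
  assume f: "f \<in> bloch_space" and g: "g \<in> bloch_space"
  then have hol: "holo_on f (ball 0 1)" "holo_on g (ball 0 1)"
    and ext: "f \<in> extensional (ball 0 1)" "g \<in> extensional (ball 0 1)"
    by (auto simp: bloch_space_def H_ball_def)
  show "bloch_dist f g = 0 \<longleftrightarrow> f = g"
  proof
    assume "bloch_dist f g = 0"
    then have "bloch_norm (\<lambda>z. f z - g z) = 0"
      using bloch_norm_diff_finite[OF f g] by simp
    then have "f z - g z = 0" if "z \<in> ball 0 1" for z
      using bloch_norm_eq_0[OF holo_on_diff[OF hol]] that by blast
    then show "f = g" using ext by (intro extensionalityI) auto
  next
    assume "f = g"
    have "(1 :: complex^'n) \<in> - {0}" by (simp add: vec_eq_iff)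
    then have ne: "- {0 :: complex^'n} \<noteq> {}" by blast
    have "cpartial (\<lambda>z. 0) k z = 0" for k and z :: "complex^'n"
      by (simp add: cpartial_def)
    then have "Q (\<lambda>z. 0) z = 0" for z :: "complex^'n"
      unfolding Q_def using ne by simp
    then have "bloch_norm (\<lambda>z :: complex^'n. 0) = 0"
      unfolding bloch_norm_def bloch_seminorm_def by simp
    then show "bloch_dist f g = 0"
      unfolding bloch_dist_def \<open>f = g\<close> by simp
  qed
  assume h: "h \<in> bloch_space"
  then have hh: "holo_on h (ball 0 1)" by (auto simp: bloch_space_def H_ball_def)
  have "bloch_norm (\<lambda>z. (f z - g z) - (h z - g z)) \<le>
        bloch_norm (\<lambda>z. f z - g z) + bloch_norm (\<lambda>z. h z - g z)"
    by (intro bloch_norm_diff_triangle holo_on_diff hol hh)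
  then have "ereal (bloch_dist f h) \<le> ereal (bloch_dist f g) + ereal (bloch_dist g h)"
    using bloch_norm_diff_finite[OF f g] bloch_norm_diff_finite[OF g h] bloch_norm_diff_finite[OF f h]
      bloch_norm_diff_commute[OF hh hol(2)] by simp
  then show "bloch_dist f h \<le> bloch_dist f g + bloch_dist g h" by simp
qed

end

theory Submission
  imports Defs "HOL-Complex_Analysis.Great_Picard"
begin

text \<open>
  Sufficiency is a normal families argument.  For a bounded sequence \<open>g\<^sub>n\<close> tending to \<open>0\<close> locally
  uniformly, the two limit conditions control \<open>\<psi> (g\<^sub>n \<circ> \<phi>)\<close> where \<open>\<phi>\<close> is close to the sphere.  Elsewhere
  the Cauchy estimates make the gradient of \<open>g\<^sub>n\<close> small, and boundedness of the operator on the
  constant function and on the coordinate functions bounds both \<open>Q\<^sub>\<psi>\<close> and \<open>\<psi>\<close> times the derivative of \<open>\<phi>\<close>.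

  For necessity, a compact operator cannot keep the images of a bounded, pointwise null sequence away
  from \<open>0\<close>.  With \<open>a = \<phi>(z)\<close> and \<open>p(w) = (1 - \<parallel>a\<parallel>\<^sup>2) / (1 - \<langle>w, a\<rangle>)\<close>, which tends to \<open>0\<close> as \<open>\<parallel>a\<parallel>\<close> tends to \<open>1\<close>,
  the function \<open>p (2 - p)\<close> has value \<open>1\<close> and gradient \<open>0\<close> at \<open>a\<close> and isolates \<open>Q\<^sub>\<psi>(z)\<close>, while \<open>(h - h(a)) p\<close>
  has value \<open>0\<close> and the gradient of \<open>h\<close> at \<open>a\<close> and isolates \<open>\<psi>(z)\<close> times the gradient of \<open>h \<circ> \<phi>\<close>.
\<close>

subsection \<open>Gradients of holomorphic functions\<close>

text \<open>This is the numerator in \<open>Q\<close>. Where \<open>f\<close> is holomorphic it is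
  the complex derivative as a linear form in \<open>u\<close>; building it from the partials lets
  the derivative be named instead of quantified.\<close>

definition cgrad :: "(complex^'n \<Rightarrow> complex) \<Rightarrow> complex^'n \<Rightarrow> complex^'n \<Rightarrow> complex" where
  "cgrad f z u = (\<Sum>k\<in>UNIV. cpartial f k z * u $ k)"

definition bergman_norm :: "complex^'n \<Rightarrow> complex^'n \<Rightarrow> real" where
  "bergman_norm z u = sqrt (Re (bergman z u u))"

lemma cgrad_scale: "cgrad f z (c *s u) = c * cgrad f z u"
  by (simp add: cgrad_def sum_distrib_left mult_ac)

lemma cgrad_eqI:
  assumes "(f has_derivative D) (at z)" "\<And>c v. D (c *s v) = c * D v"
  shows "cgrad f z = D"
  using deriv_eq_sum_cpartial[OF assms] by (auto simp: cgrad_def)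

text \<open>A complex-linear derivative is determined by its values on the basis vectors, which are
  the partials, so the existential in \<open>holo_on\<close> has only one possible witness.\<close>

lemma holo_on_iff_cgrad: "holo_on f S \<longleftrightarrow> (\<forall>z\<in>S. (f has_derivative cgrad f z) (at z))"
  unfolding holo_on_def using cgrad_eqI cgrad_scale by metis

lemma has_derivative_cgrad:
  "holo_on f S \<Longrightarrow> z \<in> S \<Longrightarrow> (f has_derivative cgrad f z) (at z)"
  by (simp add: holo_on_iff_cgrad)

lemma holo_onI:
  assumes "\<And>z. z \<in> S \<Longrightarrow> (f has_derivative D z) (at z)"
    and "\<And>z c v. z \<in> S \<Longrightarrow> D z (c *s v) = c * D z v"
  shows "holo_on f S"
  using assms unfolding holo_on_def by blast

lemma bounded_linear_vector_scalar_mult_left: "bounded_linear (\<lambda>t. t *s (u :: complex^'n))"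
  by (rule linear_conv_bounded_linear[THEN iffD1], rule linearI)
     (auto simp: vec_eq_iff algebra_simps)

text \<open>Partials depend only on the values near \<open>z\<close>. Hence a function can be
  exchanged with its restriction to the ball, which is \<open>undefined\<close> elsewhere.\<close>

lemma cpartial_cong_open:
  fixes z :: "complex^'n"
  assumes "open S" "z \<in> S" "\<And>x. x \<in> S \<Longrightarrow> f x = g x"
  shows "cpartial f k z = cpartial g k z"
  unfolding cpartial_def
proof (rule deriv_cong_ev)
  let ?g = "\<lambda>t::complex. z + t *s axis k 1"
  have "isCont ?g 0"
    by (intro continuous_add continuous_const linear_continuous_at bounded_linear_vector_scalar_mult_left)
  then have "(?g \<longlongrightarrow> z) (nhds 0)"
    using tendsto_at_iff_tendsto_nhds[of ?g 0] by (simp add: continuous_at)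
  then have "\<forall>\<^sub>F t in nhds (0::complex). z + t *s axis k 1 \<in> S"
    using assms(1,2) by (rule topological_tendstoD)
  then show "\<forall>\<^sub>F t in nhds 0. f (z + t *s axis k 1) = g (z + t *s axis k 1)"
    by eventually_elim (rule assms(3))
qed simp

lemma cgrad_cong_open:
  assumes "open S" "z \<in> S" "\<And>x. x \<in> S \<Longrightarrow> f x = g x"
  shows "cgrad f z = cgrad g z"
  using cpartial_cong_open[OF assms] by (auto simp: cgrad_def fun_eq_iff)

lemma holo_on_cong_open:
  assumes "open S" "\<And>x. x \<in> S \<Longrightarrow> f x = g x"
  shows "holo_on f S \<longleftrightarrow> holo_on g S"
  using assms has_derivative_transform_within_open[of _ _ _ UNIV S]
  unfolding holo_on_def by (metis (no_types, opaque_lifting))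

lemma has_derivative_cgrad_mult:
  assumes "holo_on f S" "holo_on g S" "z \<in> S"
  shows "((\<lambda>x. f x * g x) has_derivative (\<lambda>u. f z * cgrad g z u + cgrad f z u * g z)) (at z)"
  by (rule has_derivative_mult) (use assms has_derivative_cgrad in blast)+

lemma holo_on_mult:
  assumes "holo_on f S" "holo_on g S"
  shows "holo_on (\<lambda>x. f x * g x) S"
  by (rule holo_onI[OF has_derivative_cgrad_mult[OF assms]]) (auto simp: cgrad_scale algebra_simps)

lemma cgrad_mult:
  assumes "holo_on f S" "holo_on g S" "z \<in> S"
  shows "cgrad (\<lambda>x. f x * g x) z u = f z * cgrad g z u + g z * cgrad f z u"
  by (subst cgrad_eqI[OF has_derivative_cgrad_mult[OF assms]])
     (auto simp: cgrad_scale algebra_simps)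

lemma holo_on_const: "holo_on (\<lambda>x. c) S"
  by (rule holo_onI[where D = "\<lambda>_ _. 0"]) auto

lemma cgrad_const [simp]: "cgrad (\<lambda>x. c) z u = 0"
  by (subst cgrad_eqI[where D = "\<lambda>_. 0"]) auto

lemma cgrad_diff:
  "holo_on f S \<Longrightarrow> holo_on g S \<Longrightarrow> z \<in> S \<Longrightarrow>
    cgrad (\<lambda>x. f x - g x) z u = cgrad f z u - cgrad g z u"
  by (simp add: cgrad_def cpartial_diff left_diff_distrib sum_subtractf)

lemma has_derivative_vec_nth: "((\<lambda>x. x $ j) has_derivative (\<lambda>u. u $ j)) F"
  using bounded_linear.has_derivative[OF bounded_linear_vec_nth has_derivative_ident] .

lemma holo_on_nth: "holo_on (\<lambda>x. x $ j) S"
  by (rule holo_onI[where D = "\<lambda>_ u. u $ j"]) (auto intro: has_derivative_vec_nth)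

text \<open>Expanding \<open>\<phi>\<close> in the standard basis reduces the claim to scalar
  functions times fixed vectors.\<close>

lemma has_derivative_holo_map:
  fixes \<phi> :: "complex^'n \<Rightarrow> complex^'m"
  assumes "\<And>j. holo_on (\<lambda>z. \<phi> z $ j) S" "z \<in> S"
  shows "(\<phi> has_derivative (\<lambda>u. \<chi> j. cgrad (\<lambda>x. \<phi> x $ j) z u)) (at z)"
proof -
  have "((\<lambda>x. \<Sum>j\<in>UNIV. \<phi> x $ j *s axis j 1) has_derivative
         (\<lambda>u. \<Sum>j\<in>UNIV. cgrad (\<lambda>x. \<phi> x $ j) z u *s axis j 1)) (at z)"
    by (intro has_derivative_sum bounded_linear.has_derivative
          [OF bounded_linear_vector_scalar_mult_left] has_derivative_cgrad[OF assms])
  moreover have "(\<Sum>j\<in>UNIV. cgrad (\<lambda>x. \<phi> x $ j) z u *s axis j 1) =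
      (\<chi> j. cgrad (\<lambda>x. \<phi> x $ j) z u)" for u
    using basis_expansion[of "\<chi> j. cgrad (\<lambda>x. \<phi> x $ j) z u"] by simp
  ultimately show ?thesis by (simp add: basis_expansion)
qed

text \<open>Both parts come from the real chain rule; the composite derivative is complex linear
  because the inner one commutes with \<open>*s\<close>.\<close>

lemma
  fixes \<phi> :: "complex^'n \<Rightarrow> complex^'m"
  assumes \<phi>: "\<And>j. holo_on (\<lambda>z. \<phi> z $ j) S" and f: "holo_on f T" and im: "\<phi> ` S \<subseteq> T"
  shows holo_on_compose: "holo_on (f \<circ> \<phi>) S"
    and cgrad_compose: "z \<in> S \<Longrightarrow>
       cgrad (f \<circ> \<phi>) z u = cgrad f (\<phi> z) (\<chi> j. cgrad (\<lambda>x. \<phi> x $ j) z u)"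
proof -
  let ?D = "\<lambda>z u. cgrad f (\<phi> z) (\<chi> j. cgrad (\<lambda>x. \<phi> x $ j) z u)"
  have D: "(f \<circ> \<phi> has_derivative ?D z) (at z)" if "z \<in> S" for z
    unfolding o_def
    by (rule has_derivative_compose[OF has_derivative_holo_map has_derivative_cgrad])
       (use assms that in auto)
  have lin: "?D z (c *s u) = c * ?D z u" for z c u
  proof -
    have "(\<chi> j. cgrad (\<lambda>x. \<phi> x $ j) z (c *s u)) = c *s (\<chi> j. cgrad (\<lambda>x. \<phi> x $ j) z u)"
      by (simp add: vec_eq_iff cgrad_scale)
    then show ?thesis by (simp add: cgrad_scale)
  qed
  show "holo_on (f \<circ> \<phi>) S" by (rule holo_onI[OF D lin])
  show "cgrad (f \<circ> \<phi>) z u = ?D z u" if "z \<in> S"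
    by (subst cgrad_eqI[OF D[OF that] lin]) rule
qed

lemma has_derivative_cgrad_outer:
  assumes "holo_on f S" "z \<in> S" "(F has_field_derivative d) (at (f z))"
  shows "((\<lambda>x. F (f x)) has_derivative (\<lambda>u. d * cgrad f z u)) (at z)"
  using has_derivative_compose[OF has_derivative_cgrad[OF assms(1,2)]
      assms(3)[unfolded has_field_derivative_def]] .

lemma holo_on_inverse:
  assumes "holo_on f S" "\<And>z. z \<in> S \<Longrightarrow> f z \<noteq> 0"
  shows "holo_on (\<lambda>x. inverse (f x)) S"
  by (rule holo_onI[OF has_derivative_cgrad_outer[OF assms(1) _ DERIV_inverse]])
     (auto simp: assms(2) cgrad_scale)

lemma norm_vector_scalar_mult: "norm (c *s u) = cmod c * norm (u :: complex^'n)"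
  by (simp add: norm_vec_def L2_set_def norm_mult power_mult_distrib sum_distrib_left[symmetric]
      real_sqrt_mult)

text \<open>Along the complex line through \<open>w\<close> in direction \<open>u\<close>,
  \<open>f\<close> becomes a function of one variable on a disc, where the classical Cauchy
  inequality bounds the first derivative.\<close>

lemma Cauchy_estimate_cgrad:
  fixes f :: "complex^'n \<Rightarrow> complex"
  assumes f: "holo_on f S" and S: "cball w r \<subseteq> S" and r: "0 < r"
    and M: "\<And>x. x \<in> cball w r \<Longrightarrow> cmod (f x) \<le> M"
  shows "cmod (cgrad f w u) \<le> M / r * norm u"
proof (cases "u = 0")
  case True
  then show ?thesis by (simp add: cgrad_def)
next
  case False
  \<comment> \<open>The largest radius for which the disc of parameters \<open>t\<close> is carried
    into \<open>cball w r\<close>; dividing by it produces the factor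
    \<open>norm u / r\<close>.\<close>
  define R where "R = r / norm u"
  have R: "0 < R" using False r by (simp add: R_def)
  define g where "g = (\<lambda>t::complex. f (w + t *s u))"
  have in_ball: "w + t *s u \<in> cball w r" if "cmod t \<le> R" for t
    using that False by (simp add: dist_norm norm_vector_scalar_mult R_def field_simps)
  have gd: "(g has_field_derivative cgrad f (w + t *s u) u) (at t)" if "cmod t \<le> R" for t
  proof -
    have 1: "((\<lambda>t. w + t *s u) has_derivative (\<lambda>t. t *s u)) (at t)"
      using has_derivative_add[OF has_derivative_const

            bounded_linear.has_derivative[OF bounded_linear_vector_scalar_mult_left has_derivative_ident]] by simp
    have "(g has_derivative (\<lambda>s. cgrad f (w + t *s u) (s *s u))) (at t)"
      unfolding g_def
      by (rule has_derivative_compose[OF 1 has_derivative_cgrad[OF f]]) (use in_ball[OF that] S in auto)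
    then show ?thesis
      unfolding has_field_derivative_def cgrad_scale by (simp add: mult_commute_abs)
  qed
  have "cmod ((deriv ^^ 1) g 0) \<le> fact 1 * M / R ^ 1"
  proof (rule Cauchy_inequality[OF _ _ R])
    show "g holomorphic_on ball 0 R"
      by (rule holomorphic_onI) (meson gd field_differentiable_at_within field_differentiable_def
          less_imp_le mem_ball_0)
    show "continuous_on (cball 0 R) g"
      by (rule continuous_at_imp_continuous_on) (auto dest!: gd intro: DERIV_isCont)
    show "cmod (g x) \<le> M" if "cmod (0 - x) = R" for x
      unfolding g_def by (rule M[OF in_ball]) (use that in auto)
  qed
  moreover have "deriv g 0 = cgrad f w u"
    using DERIV_imp_deriv[OF gd[of 0]] R by simp
  ultimately show ?thesis by (simp add: R_def)
qed

section \<open>Bergman length of tangent vectors, \<open>Q\<close> and the Bloch seminorm\<close>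

lemma bergman_norm_pos: "z \<in> ball 0 1 \<Longrightarrow> u \<noteq> 0 \<Longrightarrow> 0 < bergman_norm z u"
  using bergman_diag_pos[of z u] by (simp add: bergman_norm_def)

lemma bergman_norm_0 [simp]: "bergman_norm z 0 = 0"
  by (simp add: bergman_norm_def bergman_def herm_def)

lemma bergman_norm_nonneg: "z \<in> ball 0 1 \<Longrightarrow> 0 \<le> bergman_norm z u"
  using bergman_norm_pos[of z u] by (cases "u = 0") auto

lemma Q_eq: "Q f z = (SUP u\<in>-{0}. ereal (cmod (cgrad f z u) / bergman_norm z u))"
  by (simp add: Q_def cgrad_def bergman_norm_def)

lemma Q_le_iff:
  assumes "z \<in> ball 0 1"
  shows "Q f z \<le> ereal c \<longleftrightarrow> (\<forall>u. cmod (cgrad f z u) \<le> c * bergman_norm z u)"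
proof -
  have "Q f z \<le> ereal c \<longleftrightarrow> (\<forall>u\<in>-{0}. cmod (cgrad f z u) / bergman_norm z u \<le> c)"
    by (simp add: Q_eq SUP_le_iff)
  also have "\<dots> \<longleftrightarrow> (\<forall>u\<in>-{0}. cmod (cgrad f z u) \<le> c * bergman_norm z u)"
    using bergman_norm_pos[OF assms] by (intro ball_cong) (auto simp: pos_divide_le_eq)
  also have "\<dots> \<longleftrightarrow> (\<forall>u. cmod (cgrad f z u) \<le> c * bergman_norm z u)"
  proof -
    have "cmod (cgrad f z 0) \<le> c * bergman_norm z 0" by (simp add: cgrad_def)
    then show ?thesis by (metis ComplI singletonD)
  qed
  finally show ?thesis .
qed

lemma bloch_seminorm_le_iff:
  "bloch_seminorm f \<le> ereal c \<longleftrightarrow>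
     (\<forall>z\<in>ball 0 1. \<forall>u. cmod (cgrad f z u) \<le> c * bergman_norm z u)"
  by (simp add: bloch_seminorm_def SUP_le_iff Q_le_iff)

lemma bloch_norm_cong:
  assumes "\<And>z. z \<in> ball 0 1 \<Longrightarrow> f z = g z"
  shows "bloch_norm f = bloch_norm g"
proof -
  have "Q f z = Q g z" if "z \<in> ball 0 1" for z
    unfolding Q_eq using cgrad_cong_open[OF open_ball that assms] by simp
  then have "bloch_seminorm f = bloch_seminorm g"
    unfolding bloch_seminorm_def by simp
  then show ?thesis by (simp add: bloch_norm_def assms)
qed

lemma herm_self: "herm u u = of_real ((norm u)\<^sup>2)"
  by (simp add: herm_def norm_vec_def L2_set_def sum_nonneg complex_norm_square[symmetric])

lemma norm_herm_le: "cmod (herm u v) \<le> norm u * norm v"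
proof -
  have "cmod (herm u v) \<le> (\<Sum>j\<in>UNIV. \<bar>cmod (u $ j)\<bar> * \<bar>cmod (v $ j)\<bar>)"
    unfolding herm_def by (rule order_trans[OF norm_sum]) (simp add: norm_mult)
  also have "\<dots> \<le> norm u * norm v"
    unfolding norm_vec_def by (rule L2_set_mult_ineq)
  finally show ?thesis .
qed

text \<open>Cauchy-Schwarz bounds the radial term by \<open>(norm u * norm z)\<^sup>2\<close>, which
  is exactly what the factor \<open>1 - (norm z)\<^sup>2\<close> takes away from
  \<open>(norm u)\<^sup>2\<close>.\<close>

lemma bergman_norm_le:
  fixes z :: "complex^'n"
  assumes "norm z < 1"
  shows "bergman_norm z u \<le> sqrt ((real CARD('n) + 1) / 2) * norm u / (1 - (norm z)\<^sup>2)"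
proof -
  have n: "(norm z)\<^sup>2 < 1" using assms by (simp add: power_less_one_iff abs_square_less_1)
  have "herm z u = cnj (herm u z)" by (simp add: herm_def mult.commute)
  then have 2: "herm u z * herm z u = of_real ((cmod (herm u z))\<^sup>2)"
    by (simp only: complex_norm_square)
  have "bergman z u u = of_real ((real CARD('n) + 1) / 2 *
     (((1 - (norm z)\<^sup>2) * (norm u)\<^sup>2 + (cmod (herm u z))\<^sup>2) / (1 - (norm z)\<^sup>2)\<^sup>2))"
    unfolding bergman_def herm_self 2 by simp
  then have "Re (bergman z u u) = (real CARD('n) + 1) / 2 *
     (((1 - (norm z)\<^sup>2) * (norm u)\<^sup>2 + (cmod (herm u z))\<^sup>2) / (1 - (norm z)\<^sup>2)\<^sup>2)"
    by (metis Re_complex_of_real)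
  also have "\<dots> \<le> (real CARD('n) + 1) / 2 * ((norm u)\<^sup>2 / (1 - (norm z)\<^sup>2)\<^sup>2)"
  proof (intro mult_left_mono divide_right_mono)
    have "(cmod (herm u z))\<^sup>2 \<le> (norm u * norm z)\<^sup>2"
      by (intro power_mono norm_herm_le) simp
    then show "(1 - (norm z)\<^sup>2) * (norm u)\<^sup>2 + (cmod (herm u z))\<^sup>2 \<le> (norm u)\<^sup>2"
      by (simp add: algebra_simps power_mult_distrib)
  qed auto
  finally have "bergman_norm z u \<le> sqrt ((real CARD('n) + 1) / 2 * ((norm u)\<^sup>2 / (1 - (norm z)\<^sup>2)\<^sup>2))"
    unfolding bergman_norm_def by (rule real_sqrt_le_mono)
  also have "\<dots> = sqrt ((real CARD('n) + 1) / 2) * norm u / (1 - (norm z)\<^sup>2)"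
    using n by (simp only: real_sqrt_mult real_sqrt_divide real_sqrt_abs) simp
  finally show ?thesis .
qed

subsection \<open>Normal families\<close>

lemma holo_on_Lipschitz:
  assumes f: "holo_on f S" and T: "convex T" "T \<subseteq> S"
    and B: "\<And>x u. x \<in> T \<Longrightarrow> cmod (cgrad f x u) \<le> B * norm u" and xy: "x \<in> T" "y \<in> T"
  shows "cmod (f x - f y) \<le> B * norm (x - y)"
proof (rule differentiable_bound[OF T(1) _ _ xy])
  show "(f has_derivative cgrad f x) (at x within T)" if "x \<in> T" for x
    using that T(2) f by (auto intro: has_derivative_at_withinI has_derivative_cgrad)
  show "onorm (cgrad f x) \<le> B" if "x \<in> T" for x
    using B[OF that] by (intro onorm_le)
qed

text \<open>Weierstrass' convergence theorem. Cauchy estimates at half the radius make the gradients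
  uniformly Cauchy; their limit is the derivative of \<open>g\<close>, and complex linearity
  survives the limit.\<close>

lemma holo_on_locally_uniform_limit:
  fixes f :: "nat \<Rightarrow> complex^'n \<Rightarrow> complex"
  assumes f: "\<And>n. holo_on (f n) S"
    and lim: "\<And>z. z \<in> S \<Longrightarrow> \<exists>d>0. cball z d \<subseteq> S \<and> uniform_limit (cball z d) f g sequentially"
  shows "holo_on g S"
  unfolding holo_on_def
proof
  fix z assume "z \<in> S"
  then obtain d where d: "d > 0" "cball z d \<subseteq> S" and ul: "uniform_limit (cball z d) f g sequentially"
    using lim by blast
  let ?T = "ball z (d/2)"
  have sub: "cball x (d/2) \<subseteq> cball z d" if "x \<in> ?T" for x
  proof
    fix y assume "y \<in> cball x (d/2)"
    then show "y \<in> cball z d"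
      using that dist_triangle[of z y x] by (simp add: dist_commute)
  qed
  have TS: "?T \<subseteq> S" using d by (auto simp: subset_iff)
  have cauchy: "\<exists>N. \<forall>m\<ge>N. \<forall>n\<ge>N. \<forall>x\<in>?T. \<forall>u.
      cmod (cgrad (f n) x u - cgrad (f m) x u) \<le> e * norm u" if e: "e > 0" for e
  proof -
    \<comment> \<open>Two terms within \<open>e * d / 4\<close> of \<open>g\<close> differ by at
      most \<open>e * d / 2\<close>; the Cauchy estimate divides this by the radius
      \<open>d / 2\<close>, leaving \<open>e\<close>.\<close>
    have "e * d / 4 > 0" using e d by simp
    then obtain N where N: "\<And>n x. n \<ge> N \<Longrightarrow> x \<in> cball z d \<Longrightarrow> dist (f n x) (g x) < e * d / 4"
      using ul unfolding uniform_limit_iff eventually_sequentially by meson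
    show ?thesis
    proof (intro exI allI impI ballI)
      fix m n x u assume mn: "m \<ge> N" "n \<ge> N" and x: "x \<in> ?T"
      have "cmod (cgrad (\<lambda>y. f n y - f m y) x u) \<le> (e * d / 2) / (d / 2) * norm u"
      proof (rule Cauchy_estimate_cgrad[OF holo_on_diff[OF f f]])
        show "cball x (d/2) \<subseteq> S" using sub[OF x] d by blast
        fix y assume "y \<in> cball x (d/2)"
        then have y: "y \<in> cball z d" using sub[OF x] by blast
        show "cmod (f n y - f m y) \<le> e * d / 2"
          using N[OF mn(1) y] N[OF mn(2) y] dist_triangle2[of "f n y" "f m y" "g y"]
          by (simp add: dist_norm)
      qed (use d in auto)
      then show "cmod (cgrad (f n) x u - cgrad (f m) x u) \<le> e * norm u"
        using d TS x by (simp add: cgrad_diff[OF f f] subset_iff)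
    qed
  qed
  define D where "D = (\<lambda>x u. lim (\<lambda>n. cgrad (f n) x u))"
  have D: "(\<lambda>n. cgrad (f n) x u) \<longlonglongrightarrow> D x u" if x: "x \<in> ?T" for x u
  proof -
    have "Cauchy (\<lambda>n. cgrad (f n) x u)"
    proof (rule metric_CauchyI)
      fix e :: real assume e: "e > 0"
      \<comment> \<open>The summand 1 covers \<open>u = 0\<close> and makes the final inequality
        strict.\<close>
      then have "e / (norm u + 1) > 0" by (simp add: add_nonneg_pos)
      from cauchy[OF this] obtain N where N: "\<And>m n. m \<ge> N \<Longrightarrow> n \<ge> N \<Longrightarrow>
          cmod (cgrad (f n) x u - cgrad (f m) x u) \<le> e / (norm u + 1) * norm u"
        using x by blast
      have "e / (norm u + 1) * norm u < e"
      proof -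
        have "norm u + 1 > 0" using norm_ge_zero[of u] by linarith
        moreover have "e * norm u < e * (norm u + 1)" using e by simp
        ultimately show ?thesis by (simp add: pos_divide_less_eq del: mult_less_cancel_left)
      qed
      then have "dist (cgrad (f m) x u) (cgrad (f n) x u) < e" if "m \<ge> N" "n \<ge> N" for m n
        using N[OF that(2,1)] unfolding dist_norm by (rule order.strict_trans1[rotated])
      then show "\<exists>N. \<forall>m\<ge>N. \<forall>n\<ge>N. dist (cgrad (f m) x u) (cgrad (f n) x u) < e" by blast
    qed
    then show ?thesis unfolding D_def
      using Cauchy_convergent convergent_LIMSEQ_iff by blast
  qed
  have lin: "D x (c *s u) = c * D x u" if "x \<in> ?T" for x c u
    using D[OF that, of "c *s u"] tendsto_mult_left[OF D[OF that, of u], of c]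
    by (simp add: cgrad_scale LIMSEQ_unique)
  have "\<exists>h. \<forall>x\<in>?T. (\<lambda>n. f n x) \<longlonglongrightarrow> h x \<and> (h has_derivative D x) (at x within ?T)"
  proof (rule has_derivative_sequence)
    show "z \<in> ?T" using d by simp
    show "(\<lambda>n. f n z) \<longlonglongrightarrow> g z"
      by (rule tendsto_uniform_limitI[OF ul]) (use d in simp)
    show "(f n has_derivative cgrad (f n) x) (at x within ?T)" if "x \<in> ?T" for n x
      by (rule has_derivative_at_withinI[OF has_derivative_cgrad[OF f]]) (use that TS in blast)
    fix e :: real assume "e > 0"
    from cauchy[OF this] obtain N where N: "\<And>m n x u. m \<ge> N \<Longrightarrow> n \<ge> N \<Longrightarrow> x \<in> ?T \<Longrightarrow>
          cmod (cgrad (f n) x u - cgrad (f m) x u) \<le> e * norm u"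
      by blast
    have "cmod (cgrad (f n) x u - D x u) \<le> e * norm u" if n: "n \<ge> N" and x: "x \<in> ?T" for n x u
    proof (rule LIMSEQ_le_const2)
      show "(\<lambda>m. cmod (cgrad (f n) x u - cgrad (f m) x u)) \<longlonglongrightarrow> cmod (cgrad (f n) x u - D x u)"
        by (intro tendsto_intros D x)
      show "\<exists>N. \<forall>m\<ge>N. cmod (cgrad (f n) x u - cgrad (f m) x u) \<le> e * norm u"
        using N n x by blast
    qed
    then show "\<forall>\<^sub>F n in sequentially. \<forall>x\<in>?T. \<forall>u. cmod (cgrad (f n) x u - D x u) \<le> e * norm u"
      unfolding eventually_sequentially by blast
  qed simp
  then obtain h where h: "\<And>x. x \<in> ?T \<Longrightarrow> (\<lambda>n. f n x) \<longlonglongrightarrow> h x"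
      "\<And>x. x \<in> ?T \<Longrightarrow> (h has_derivative D x) (at x within ?T)" by blast
  have z: "z \<in> ?T" using d by simp
  \<comment> \<open>So far \<open>h\<close> is only known to exist as a pointwise limit; uniqueness
    of limits identifies it with \<open>g\<close> near \<open>z\<close>.\<close>
  have hg: "h x = g x" if "x \<in> ?T" for x
    by (rule LIMSEQ_unique[OF h(1)[OF that] tendsto_uniform_limitI[OF ul]]) (use that d in simp)
  have "(h has_derivative D z) (at z)"
    using h(2)[OF z] by (simp only: at_within_open[OF z open_ball])
  then have "(g has_derivative D z) (at z)"
    by (rule has_derivative_transform_within_open[OF _ open_ball z hg])
  then show "\<exists>D. (g has_derivative D) (at z) \<and> (\<forall>c v. D (c *s v) = c * D v)"
    using lin[OF z] by blast
qed

text \<open>Montel's theorem. Every compact subset of the ball lies in some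
  \<open>cball 0 \<rho>\<close> with \<open>\<rho> < 1\<close>, so uniform limits on these amount to
  locally uniform convergence.\<close>

lemma Montel_ball:
  fixes f :: "nat \<Rightarrow> complex^'n \<Rightarrow> complex"
  assumes f: "\<And>n. holo_on (f n) (ball 0 1)"
    and M: "\<And>n x. x \<in> ball 0 1 \<Longrightarrow> cmod (f n x) \<le> M"
  obtains g r where "strict_mono r" "holo_on g (ball 0 1)" "\<And>x. x \<in> ball 0 1 \<Longrightarrow> cmod (g x) \<le> M"
    "\<And>\<rho>. \<rho> < 1 \<Longrightarrow> uniform_limit (cball 0 \<rho>) (\<lambda>n. f (r n)) g sequentially"
proof -
  have M0: "0 \<le> M" using order_trans[OF norm_ge_zero M[of 0 0]] by simp
  \<comment> \<open>The weight makes the family equicontinuous up to the sphere, where it vanishes, so that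
    Arzela--Ascoli applies to the closed ball and no diagonal sequence is needed.\<close>
  define F where "F = (\<lambda>n x. (1 - norm x) *\<^sub>R f n x)"
  have F_norm: "cmod (F n x) \<le> (1 - norm x) * M" if "x \<in> cball 0 1" for n x
    using that M[of x n] by (cases "norm x = 1") (auto simp: F_def mult_left_mono)
  obtain G r where "continuous_on (cball 0 1) G" and r: "strict_mono (r :: nat \<Rightarrow> nat)"
    and lim: "\<And>e. 0 < e \<Longrightarrow> \<exists>N. \<forall>n x. n \<ge> N \<and> x \<in> cball 0 1 \<longrightarrow> cmod (F (r n) x - G x) < e"
  proof (rule Arzela_Ascoli[of "cball 0 1" F M])
    show "cmod (F n x) \<le> M" if "x \<in> cball 0 1" for n x
    proof -
      have "(1 - norm x) * M \<le> 1 * M" using that M0 by (intro mult_right_mono) auto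
      then show ?thesis using F_norm[OF that, of n] by linarith
    qed
    fix x :: "complex^'n" and e :: real assume x: "x \<in> cball 0 1" and e: "0 < e"
    show "\<exists>d>0. \<forall>n y. y \<in> cball 0 1 \<and> norm (x - y) < d \<longrightarrow> cmod (F n x - F n y) < e"
    proof (cases "norm x = 1")
      case True
      \<comment> \<open>On the sphere \<open>F n x = 0\<close>, and \<open>1 - norm y\<close> is at
        most \<open>norm (x - y)\<close>, so the bound on \<open>F n y\<close> alone suffices.
        \<open>M + 1\<close> replaces \<open>M\<close>, which may be zero.\<close>
      have "cmod (F n x - F n y) < e" if y: "y \<in> cball 0 1" "norm (x - y) < e / (M + 1)" for n y
      proof -
        have "cmod (F n x - F n y) = cmod (F n y)" using True by (simp add: F_def)
        also have "\<dots> \<le> (1 - norm y) * M" by (rule F_norm[OF y(1)])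
        also have "\<dots> \<le> norm (x - y) * (M + 1)"
          using True M0 norm_triangle_ineq2[of x y] by (intro mult_mono) auto
        also have "\<dots> < e" using y(2) M0 by (simp add: pos_less_divide_eq)
        finally show ?thesis .
      qed
      then show ?thesis using e M0 by (intro exI[of _ "e / (M + 1)"]) auto
    next
      case False
      \<comment> \<open>A third of the distance to the sphere leaves room for a ball of radius
        \<open>\<delta>\<close> about every point of \<open>cball x \<delta>\<close>: norms reach at
        most \<open>norm x + 2 * \<delta>\<close>, which is below 1.\<close>
      define \<delta> where "\<delta> = (1 - norm x) / 3"
      have \<delta>: "\<delta> > 0" using x False by (simp add: \<delta>_def)
      have cb: "cball y \<delta> \<subseteq> ball 0 1" if "y \<in> cball x \<delta>" for y
      proof
        fix w assume "w \<in> cball y \<delta>"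
        then have "norm w \<le> norm x + 2 * \<delta>"
          using that norm_triangle_ineq2[of y x] norm_triangle_ineq2[of w y]
          by (simp add: dist_norm norm_minus_commute)
        then show "w \<in> ball 0 1" using \<delta> by (simp add: \<delta>_def field_simps)
      qed
      have cx: "cball x \<delta> \<subseteq> ball 0 1" using cb[of x] \<delta> by simp
      \<comment> \<open>\<open>M / \<delta>\<close> is the Lipschitz constant of \<open>f n\<close>
        near \<open>x\<close>, \<open>M\<close> pays for the change of the weight, and 1 keeps
        \<open>L\<close> positive when \<open>M = 0\<close>.\<close>
      define L where "L = M / \<delta> + M + 1"
      have L: "L > 0" using M0 \<delta> by (simp add: L_def add_nonneg_pos)
      have "cmod (F n x - F n y) < e" if y: "norm (x - y) < min \<delta> (e / L)" for n y
      proof -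
        have yx: "y \<in> cball x \<delta>" using y by (simp add: dist_norm)
        have "cmod (f n x - f n y) \<le> M / \<delta> * norm (x - y)"
        proof (rule holo_on_Lipschitz[OF f convex_cball cx _ _ yx])
          show "cmod (cgrad (f n) w u) \<le> M / \<delta> * norm u" if "w \<in> cball x \<delta>" for w u
            by (rule Cauchy_estimate_cgrad[OF f cb[OF that] \<delta>]) (use cb[OF that] M in blast)
        qed (use \<delta> in simp)
        then have "(1 - norm x) * cmod (f n x - f n y) \<le> 1 * (M / \<delta> * norm (x - y))"
          using x by (intro mult_mono) auto
        moreover have "\<bar>norm y - norm x\<bar> * cmod (f n y) \<le> norm (x - y) * M"
          using cx yx M norm_triangle_ineq3[of y x] by (intro mult_mono) (auto simp: norm_minus_commute)
        moreover have "F n x - F n y = (1 - norm x) *\<^sub>R (f n x - f n y) + (norm y - norm x) *\<^sub>R f n y"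
          by (simp add: F_def algebra_simps)
        ultimately have "cmod (F n x - F n y) \<le> M / \<delta> * norm (x - y) + norm (x - y) * M"
          using x norm_triangle_ineq[of "(1 - norm x) *\<^sub>R (f n x - f n y)" "(norm y - norm x) *\<^sub>R f n y"]
          by simp
        also have "\<dots> \<le> norm (x - y) * L" by (simp add: L_def algebra_simps)
        also have "\<dots> < e" using y L by (simp add: pos_less_divide_eq)
        finally show ?thesis .
      qed
      then show ?thesis using e L \<delta> by (intro exI[of _ "min \<delta> (e / L)"]) auto
    qed
  qed (auto intro: compact_cball)
  \<comment> \<open>The weight is divided out again. On \<open>cball 0 \<rho>\<close> it is at least
    \<open>1 - \<rho>\<close>, which is why \<open>G\<close> is approximated below to within
    \<open>e * (1 - \<rho>)\<close>.\<close>
  define g where "g = (\<lambda>x. (1 / (1 - norm x)) *\<^sub>R G x)"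
  have ul: "uniform_limit (cball 0 \<rho>) (\<lambda>n. f (r n)) g sequentially" if \<rho>: "\<rho> < 1" for \<rho>
    unfolding uniform_limit_iff eventually_sequentially
  proof (intro allI impI)
    fix e :: real assume "e > 0"
    then have "e * (1 - \<rho>) > 0" using \<rho> by simp
    from lim[OF this] obtain N where
      N: "\<And>n x. n \<ge> N \<Longrightarrow> x \<in> cball 0 1 \<Longrightarrow> cmod (F (r n) x - G x) < e * (1 - \<rho>)" by blast
    have "dist (f (r n) x) (g x) < e" if n: "n \<ge> N" and x: "x \<in> cball 0 \<rho>" for n x
    proof -
      have x1: "norm x \<le> \<rho>" "norm x < 1" using x \<rho> by auto
      have "F (r n) x - G x = (1 - norm x) *\<^sub>R (f (r n) x - g x)"
        using x1 by (simp add: F_def g_def scaleR_diff_right)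
      then have "cmod (F (r n) x - G x) = (1 - norm x) * dist (f (r n) x) (g x)"
        using x1 by (simp add: dist_norm)
      then have "(1 - norm x) * dist (f (r n) x) (g x) < e * (1 - \<rho>)"
        using N[OF n, of x] x1 by simp
      also have "\<dots> \<le> (1 - norm x) * e" using x1 \<open>e > 0\<close> by simp
      finally show ?thesis using x1 by simp
    qed
    then show "\<exists>N. \<forall>n\<ge>N. \<forall>x\<in>cball 0 \<rho>. dist (f (r n) x) (g x) < e" by blast
  qed
  have "holo_on g (ball 0 1)"
  proof (rule holo_on_locally_uniform_limit[where f = "\<lambda>n. f (r n)"])
    fix z :: "complex^'n" assume z: "z \<in> ball 0 1"
    define d where "d = (1 - norm z) / 2"
    have d: "d > 0" "norm z + d < 1" using z by (simp_all add: d_def field_simps)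
    have *: "cball z d \<subseteq> cball 0 (norm z + d)"
    proof
      fix x assume "x \<in> cball z d"
      then show "x \<in> cball 0 (norm z + d)"
        using norm_triangle_ineq2[of x z] by (simp add: dist_norm norm_minus_commute)
    qed
    also have "\<dots> \<subseteq> ball 0 1" using d by auto
    finally show "\<exists>d>0. cball z d \<subseteq> ball 0 1 \<and> uniform_limit (cball z d) (\<lambda>n. f (r n)) g sequentially"
      using d uniform_limit_on_subset[OF ul[OF d(2)] *] by blast
  qed (rule f)
  moreover have "cmod (g x) \<le> M" if x: "x \<in> ball 0 1" for x
  proof (rule LIMSEQ_le_const2)
    show "(\<lambda>n. cmod (f (r n) x)) \<longlonglongrightarrow> cmod (g x)"
      by (intro tendsto_norm tendsto_uniform_limitI[OF ul[of "norm x"]]) (use x in auto)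
    show "\<exists>N. \<forall>n\<ge>N. cmod (f (r n) x) \<le> M" using M[OF x] by blast
  qed
  ultimately show ?thesis using that[OF r _ _ ul] by blast
qed

subsection \<open>Weighted composition operators\<close>

lemma norm_le_sup_norm:
  assumes "f \<in> H_inf" "z \<in> ball 0 1"
  shows "cmod (f z) \<le> sup_norm f"
  unfolding sup_norm_def
proof (rule cSUP_upper[OF assms(2)])
  have "bounded (f ` ball 0 1)" using assms(1) by (simp add: H_inf_def)
  then show "bdd_above ((\<lambda>z. cmod (f z)) ` ball 0 1)"
    by (auto simp: bounded_iff bdd_above_def)
qed

lemma sup_norm_le:
  assumes "\<And>z. z \<in> ball 0 1 \<Longrightarrow> cmod (f z) \<le> C"
  shows "sup_norm f \<le> C"
  unfolding sup_norm_def using assms by (intro cSUP_least) auto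

lemma H_inf_imp_holo_on: "f \<in> H_inf \<Longrightarrow> holo_on f (ball 0 1)"
  by (simp add: H_inf_def H_ball_def)

text \<open>\<open>H_inf\<close> contains only functions that are \<open>undefined\<close> off the
  ball, so a formula has to be restricted before it can serve as a test function.\<close>

lemma restrict_in_H_inf:
  assumes "holo_on f (ball 0 1)" "\<And>z. z \<in> ball 0 1 \<Longrightarrow> cmod (f z) \<le> C"
  shows "restrict f (ball 0 1) \<in> H_inf" "sup_norm (restrict f (ball 0 1)) \<le> C"
proof -
  have "holo_on (restrict f (ball 0 1)) (ball 0 1)"
    using assms(1) by (subst holo_on_cong_open[where g = f]) auto
  then show "restrict f (ball 0 1) \<in> H_inf"
    using assms(2) by (auto simp: H_inf_def H_ball_def bounded_iff intro!: exI[of _ C])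
  show "sup_norm (restrict f (ball 0 1)) \<le> C"
    by (rule sup_norm_le) (use assms(2) in auto)
qed

lemma bloch_seminorm_le_norm: "bloch_seminorm f \<le> bloch_norm f"
  unfolding bloch_norm_def by (simp add: ereal_le_add_self2)

lemma bloch_space_imp_bound:
  assumes "f \<in> bloch_space"
  obtains C where "0 \<le> C" "\<And>z u. z \<in> ball 0 1 \<Longrightarrow> cmod (cgrad f z u) \<le> C * bergman_norm z u"
proof -
  have "bloch_seminorm f = ereal (real_of_ereal (bloch_seminorm f))"
    using assms bloch_seminorm_nonneg[of f] by (auto simp: bloch_space_def ereal_real)
  then have "bloch_seminorm f \<le> ereal (real_of_ereal (bloch_seminorm f))" by simp
  then show ?thesis
    using that[of "real_of_ereal (bloch_seminorm f)"] bloch_seminorm_nonneg[of f]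
    unfolding bloch_seminorm_le_iff by (simp add: real_of_ereal_pos)
qed

lemma bloch_norm_leD:
  assumes "bloch_norm f \<le> ereal c"
  shows "cmod (f 0) \<le> c" "0 \<le> c"
    "z \<in> ball 0 1 \<Longrightarrow> cmod (cgrad f z u) \<le> c * bergman_norm z u"
proof -
  have "ereal (cmod (f 0)) \<le> bloch_norm f"
    unfolding bloch_norm_def using bloch_seminorm_nonneg[of f] by (rule ereal_le_add_self)
  then show "cmod (f 0) \<le> c" using assms by (metis ereal_less_eq(3) order_trans)
  then show "0 \<le> c" using norm_ge_zero order_trans by blast
  have "bloch_seminorm f \<le> ereal c" using bloch_seminorm_le_norm assms by (rule order_trans)
  then show "z \<in> ball 0 1 \<Longrightarrow> cmod (cgrad f z u) \<le> c * bergman_norm z u"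
    unfolding bloch_seminorm_le_iff by blast
qed

lemma bloch_norm_leI:
  assumes "cmod (f 0) \<le> a" "a + b \<le> c"
    "\<And>z u. z \<in> ball 0 1 \<Longrightarrow> cmod (cgrad f z u) \<le> b * bergman_norm z u"
  shows "bloch_norm f \<le> ereal c"
proof -
  have "bloch_seminorm f \<le> ereal b" using assms(3) by (simp add: bloch_seminorm_le_iff)
  then have "bloch_norm f \<le> ereal a + ereal b"
    unfolding bloch_norm_def using assms(1) by (intro add_mono) auto
  also have "\<dots> \<le> ereal c" using assms(2) by simp
  finally show ?thesis .
qed

lemma bloch_norm_scale_le:
  assumes "holo_on f (ball 0 1)" "bloch_norm f \<le> ereal B"
  shows "bloch_norm (\<lambda>z. c * f z) \<le> ereal (cmod c * B)"
proof -
  obtain s where s: "bloch_seminorm f = ereal s"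
    using bloch_seminorm_nonneg[of f] order_trans[OF bloch_seminorm_le_norm assms(2)]
    by (cases "bloch_seminorm f") auto
  have s': "cmod (f 0) + s \<le> B" using assms(2) by (simp add: bloch_norm_def s)
  show ?thesis
  proof (rule bloch_norm_leI)
    show "cmod (c * f 0) \<le> cmod c * cmod (f 0)" by (simp add: norm_mult)
    show "cmod c * cmod (f 0) + cmod c * s \<le> cmod c * B"
      using mult_left_mono[OF s', of "cmod c"] by (simp add: distrib_left)
    fix z u :: "complex^'a" assume z: "z \<in> ball 0 1"
    have "cmod (cgrad f z u) \<le> s * bergman_norm z u"
      using s z bloch_seminorm_le_iff[of f s] by simp
    then show "cmod (cgrad (\<lambda>z. c * f z) z u) \<le> cmod c * s * bergman_norm z u"
      using cgrad_mult[OF holo_on_const assms(1) z, of c u]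
      by (simp add: norm_mult mult.assoc mult_left_mono)
  qed
qed

text \<open>Point evaluations are continuous in the Bloch norm: the gradient bound is uniform on
  \<open>cball 0 (norm w)\<close>, and the mean value inequality carries it from 0 to
  \<open>w\<close>.\<close>

lemma bloch_norm_pointwise_bound:
  fixes f :: "complex^'n \<Rightarrow> complex"
  assumes f: "holo_on f (ball 0 1)" and c: "bloch_norm f \<le> ereal c" and w: "w \<in> ball 0 1"
  shows "cmod (f w) \<le> (1 + sqrt ((real CARD('n) + 1) / 2) / (1 - (norm w)\<^sup>2)) * c"
proof -
  define \<kappa> where "\<kappa> = sqrt ((real CARD('n) + 1) / 2)"
  have \<kappa>: "\<kappa> \<ge> 0" by (simp add: \<kappa>_def)
  note c' = bloch_norm_leD[OF c]
  have w2: "(norm w)\<^sup>2 < 1" using w by (simp add: power_less_one_iff abs_square_less_1)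
  have "cmod (f w - f 0) \<le> c * \<kappa> / (1 - (norm w)\<^sup>2) * norm (w - 0)"
  proof (rule holo_on_Lipschitz[OF f convex_cball])
    show "cball 0 (norm w) \<subseteq> ball 0 1" using w by auto
    fix x u :: "complex^'n" assume x: "x \<in> cball 0 (norm w)"
    then have x': "norm x < 1" "(norm x)\<^sup>2 \<le> (norm w)\<^sup>2" "(norm x)\<^sup>2 < 1"
      using w by (auto intro: power_mono simp: power_less_one_iff abs_square_less_1)
    have "cmod (cgrad f x u) \<le> c * bergman_norm x u" using x' by (intro c'(3)) simp
    also have "\<dots> \<le> c * (\<kappa> * norm u / (1 - (norm x)\<^sup>2))"
      unfolding \<kappa>_def using x' c' by (intro mult_left_mono bergman_norm_le)
    also have "\<dots> \<le> c * (\<kappa> * norm u / (1 - (norm w)\<^sup>2))"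
      using x' w2 c' \<kappa> by (intro mult_left_mono divide_left_mono mult_pos_pos) auto
    finally show "cmod (cgrad f x u) \<le> c * \<kappa> / (1 - (norm w)\<^sup>2) * norm u" by simp
  qed auto
  also have "\<dots> \<le> c * \<kappa> / (1 - (norm w)\<^sup>2) * 1"
    using w w2 \<kappa> c' by (intro mult_left_mono) auto
  finally have "cmod (f w) \<le> c + c * \<kappa> / (1 - (norm w)\<^sup>2)"
    using c'(1) norm_triangle_ineq2[of "f w" "f 0"] by simp
  then show ?thesis by (simp add: \<kappa>_def algebra_simps)
qed

text \<open>Bolzano-Weierstrass for relatively compact sets: the subsequential limit may leave
  \<open>S\<close>, since it is the closure that is compact.\<close>

lemma (in Metric_space) compactin_closure_of_sequentially:
  assumes "S \<subseteq> M"
  shows "compactin mtopology (mtopology closure_of S) \<longleftrightarrow>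
    (\<forall>\<sigma>::nat\<Rightarrow>'a. range \<sigma> \<subseteq> S \<longrightarrow>
       (\<exists>l r. l \<in> M \<and> strict_mono r \<and> limitin mtopology (\<sigma> \<circ> r) l sequentially))"
proof -
  \<comment> \<open>Derived sets lie in the space, so looking for accumulation points inside
    \<open>M\<close> is the same as asking for any accumulation point, and the two criteria
    match.\<close>
  have "M \<inter> mtopology derived_set_of T = mtopology derived_set_of T" for T
    using derived_set_of_subset_topspace[of mtopology T] by auto
  then show ?thesis
    unfolding compact_closure_of_eq_Bolzano_Weierstrass Bolzano_Weierstrass_property[OF assms assms]
    using assms by (simp only:) blast
qed

lemma compactin_bloch_closure_iff:
  fixes S :: "(complex^'n \<Rightarrow> complex) set"
  assumes "S \<subseteq> bloch_space"
  shows "compactin bloch_topology (bloch_topology closure_of S) \<longleftrightarrow>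
    (\<forall>\<sigma>::nat \<Rightarrow> complex^'n \<Rightarrow> complex. range \<sigma> \<subseteq> S \<longrightarrow>
       (\<exists>l\<in>bloch_space. \<exists>r. strict_mono r \<and> (\<lambda>n. bloch_dist (\<sigma> (r n)) l) \<longlonglongrightarrow> 0))"
    (is "_ \<longleftrightarrow> ?R")
proof -
  interpret Metric_space "bloch_space :: (complex^'n \<Rightarrow> complex) set" bloch_dist
    by (rule Metric_space_bloch)
  have "limitin mtopology (\<sigma> \<circ> r) l sequentially \<longleftrightarrow> (\<lambda>n. bloch_dist (\<sigma> (r n)) l) \<longlonglongrightarrow> 0"
    if "range \<sigma> \<subseteq> S" "l \<in> bloch_space" for \<sigma> :: "nat \<Rightarrow> complex^'n \<Rightarrow> complex" and r :: "nat \<Rightarrow> nat" and l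
    using that assms by (auto simp: limitin_metric_dist_null range_subsetD subset_iff)
  then have eq: "(\<exists>l r. l \<in> bloch_space \<and> strict_mono r \<and> limitin mtopology (\<sigma> \<circ> r) l sequentially) \<longleftrightarrow>
      (\<exists>l\<in>bloch_space. \<exists>r. strict_mono r \<and> (\<lambda>n. bloch_dist (\<sigma> (r n)) l) \<longlonglongrightarrow> 0)"
    if "range \<sigma> \<subseteq> S" for \<sigma> :: "nat \<Rightarrow> complex^'n \<Rightarrow> complex"
    using that by blast
  have "compactin bloch_topology (bloch_topology closure_of S) \<longleftrightarrow> (\<forall>\<sigma>::nat \<Rightarrow> complex^'n \<Rightarrow> complex. range \<sigma> \<subseteq> S \<longrightarrow>
      (\<exists>l r. l \<in> bloch_space \<and> strict_mono r \<and> limitin mtopology (\<sigma> \<circ> r) l sequentially))"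
    unfolding bloch_topology_def by (rule compactin_closure_of_sequentially[OF assms])
  also have "\<dots> \<longleftrightarrow> ?R"
    by (rule iff_allI) (rule imp_cong[OF refl], rule eq)
  finally show ?thesis .
qed

section \<open>The operator for fixed symbols, and its effect on null sequences\<close>

locale weighted_composition =
  fixes \<phi> :: "complex^'n \<Rightarrow> complex^'n" and \<psi> :: "complex^'n \<Rightarrow> complex"
  assumes \<phi>: "holo_self_map \<phi>" and \<psi>: "holo_on \<psi> (ball 0 1)"
begin

lemma \<phi>_in_ball: "z \<in> ball 0 1 \<Longrightarrow> \<phi> z \<in> ball 0 1"
  using \<phi> unfolding holo_self_map_def by blast

lemma holo_on_compose_\<phi>: "holo_on f (ball 0 1) \<Longrightarrow> holo_on (f \<circ> \<phi>) (ball 0 1)"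
  by (rule holo_on_compose[of \<phi>]) (use \<phi> in \<open>auto simp: holo_self_map_def\<close>)

lemma cgrad_compose_\<phi>:
  assumes "holo_on f (ball 0 1)" "z \<in> ball 0 1"
  shows "cgrad (f \<circ> \<phi>) z u = cgrad f (\<phi> z) (\<chi> j. cgrad (\<lambda>x. \<phi> x $ j) z u)"
  by (rule cgrad_compose[of \<phi>, OF _ assms(1) _ assms(2)]) (use \<phi> in \<open>auto simp: holo_self_map_def\<close>)

lemma wcomp_apply: "z \<in> ball 0 1 \<Longrightarrow> wcomp \<psi> \<phi> f z = \<psi> z * (f \<circ> \<phi>) z"
  by (simp add: wcomp_def)

lemma holo_on_wcomp:
  assumes "holo_on f (ball 0 1)"
  shows "holo_on (wcomp \<psi> \<phi> f) (ball 0 1)"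
proof -
  have "holo_on (wcomp \<psi> \<phi> f) (ball 0 1) \<longleftrightarrow> holo_on (\<lambda>x. \<psi> x * (f \<circ> \<phi>) x) (ball 0 1)"
    by (rule holo_on_cong_open[OF open_ball wcomp_apply])
  then show ?thesis using holo_on_mult[OF \<psi> holo_on_compose_\<phi>[OF assms]] by (rule iffD2)
qed

lemma cgrad_wcomp:
  assumes "holo_on f (ball 0 1)" "z \<in> ball 0 1"
  shows "cgrad (wcomp \<psi> \<phi> f) z u = f (\<phi> z) * cgrad \<psi> z u + \<psi> z * cgrad (f \<circ> \<phi>) z u"
proof -
  have "cgrad (wcomp \<psi> \<phi> f) z = cgrad (\<lambda>z. \<psi> z * (f \<circ> \<phi>) z) z"
    by (rule cgrad_cong_open[OF open_ball assms(2) wcomp_apply])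
  then show ?thesis
    using cgrad_mult[OF \<psi> holo_on_compose_\<phi>[OF assms(1)] assms(2), of u] by simp
qed

lemma H_inf_coordinate:
  "restrict (\<lambda>w. w $ j) (ball 0 1) \<in> (H_inf :: (complex^'n \<Rightarrow> complex) set)"
proof (rule restrict_in_H_inf[OF holo_on_nth])
  show "cmod (z $ j) \<le> 1" if "z \<in> ball 0 1" for z :: "complex^'n"
    using that Finite_Cartesian_Product.norm_nth_le[of z j] by simp
qed

text \<open>The constant 1 is sent to \<open>\<psi>\<close>, which gives \<open>A\<close>. For a
  coordinate function, the product rule expresses \<open>\<psi>\<close> times the gradient of that
  coordinate of \<open>\<phi>\<close> through the image and the gradient of \<open>\<psi>\<close>,
  which gives \<open>B\<close>.\<close>

lemma bounded_wcomp_symbol_bounds: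
  assumes W: "wcomp \<psi> \<phi> ` H_inf \<subseteq> bloch_space"
  obtains A B where "0 \<le> A" "0 \<le> B"
    "\<And>z u. z \<in> ball 0 1 \<Longrightarrow> cmod (cgrad \<psi> z u) \<le> A * bergman_norm z u"
    "\<And>z u. z \<in> ball 0 1 \<Longrightarrow> cmod (\<psi> z) * norm (\<chi> j. cgrad (\<lambda>x. \<phi> x $ j) z u) \<le> B * bergman_norm z u"
proof -
  define one where "one = restrict (\<lambda>w :: complex^'n. 1 :: complex) (ball 0 1)"
  have one: "one \<in> H_inf"
    unfolding one_def by (rule restrict_in_H_inf[where C = 1]) (auto intro: holo_on_const)
  then obtain A where A: "0 \<le> A"
    and "\<And>z u. z \<in> ball 0 1 \<Longrightarrow> cmod (cgrad (wcomp \<psi> \<phi> one) z u) \<le> A * bergman_norm z u"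
    using W bloch_space_imp_bound by (metis image_subset_iff)
  moreover have "cgrad (wcomp \<psi> \<phi> one) z = cgrad \<psi> z" if z: "z \<in> ball 0 1" for z
    by (rule cgrad_cong_open[OF open_ball z]) (use \<phi>_in_ball in \<open>auto simp: wcomp_apply one_def\<close>)
  ultimately have A\<psi>: "cmod (cgrad \<psi> z u) \<le> A * bergman_norm z u" if "z \<in> ball 0 1" for z u
    using that by simp
  define x where "x = (\<lambda>j. restrict (\<lambda>w :: complex^'n. w $ j) (ball 0 1))"
  have "\<exists>C\<ge>0. \<forall>z\<in>ball 0 1. \<forall>u. cmod (cgrad (wcomp \<psi> \<phi> (x j)) z u) \<le> C * bergman_norm z u" for j
    using W H_inf_coordinate[of j] bloch_space_imp_bound unfolding x_def by (metis image_subset_iff)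
  then obtain C where C: "\<And>j. 0 \<le> C j"
    "\<And>j z u. z \<in> ball 0 1 \<Longrightarrow> cmod (cgrad (wcomp \<psi> \<phi> (x j)) z u) \<le> C j * bergman_norm z u"
    by metis
  have comp: "cmod (\<psi> z) * cmod (cgrad (\<lambda>x. \<phi> x $ j) z u) \<le> (C j + A) * bergman_norm z u"
    if z: "z \<in> ball 0 1" for z u j
  proof -
    have "cgrad (x j \<circ> \<phi>) z = cgrad (\<lambda>x. \<phi> x $ j) z"
      by (rule cgrad_cong_open[OF open_ball z]) (use \<phi>_in_ball in \<open>auto simp: x_def\<close>)
    then have "\<psi> z * cgrad (\<lambda>x. \<phi> x $ j) z u = cgrad (wcomp \<psi> \<phi> (x j)) z u - x j (\<phi> z) * cgrad \<psi> z u"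
      using H_inf_coordinate[of j, THEN H_inf_imp_holo_on]
      by (simp add: cgrad_wcomp[OF _ z] x_def)
    then have "cmod (\<psi> z) * cmod (cgrad (\<lambda>x. \<phi> x $ j) z u) \<le>
        cmod (cgrad (wcomp \<psi> \<phi> (x j)) z u) + cmod (x j (\<phi> z)) * cmod (cgrad \<psi> z u)"
      by (metis norm_mult norm_triangle_ineq4)
    also have "\<dots> \<le> C j * bergman_norm z u + 1 * (A * bergman_norm z u)"
    proof (intro add_mono mult_mono C(2) z A\<psi>)
      show "cmod (x j (\<phi> z)) \<le> 1"
        using \<phi>_in_ball[OF z] Finite_Cartesian_Product.norm_nth_le[of "\<phi> z" j] by (simp add: x_def)
    qed auto
    finally show ?thesis by (simp add: distrib_right)
  qed
  show ?thesis
  proof (rule that[OF A _ A\<psi>])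
    show "0 \<le> (\<Sum>j\<in>UNIV. C j + A)" using A C(1) by (intro sum_nonneg) auto
    fix z u :: "complex^'n" assume z: "z \<in> ball 0 1"
    have "norm (\<chi> j. cgrad (\<lambda>x. \<phi> x $ j) z u) \<le> (\<Sum>j\<in>UNIV. cmod (cgrad (\<lambda>x. \<phi> x $ j) z u))"
      unfolding norm_vec_def by (rule order_trans[OF L2_set_le_sum]) auto
    then have "cmod (\<psi> z) * norm (\<chi> j. cgrad (\<lambda>x. \<phi> x $ j) z u) \<le>
        (\<Sum>j\<in>UNIV. cmod (\<psi> z) * cmod (cgrad (\<lambda>x. \<phi> x $ j) z u))"
      unfolding sum_distrib_left[symmetric] by (rule mult_left_mono) simp
    also have "\<dots> \<le> (\<Sum>j\<in>UNIV. (C j + A) * bergman_norm z u)"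
      by (intro sum_mono comp z)
    finally show "cmod (\<psi> z) * norm (\<chi> j. cgrad (\<lambda>x. \<phi> x $ j) z u) \<le>
        (\<Sum>j\<in>UNIV. C j + A) * bergman_norm z u"
      by (simp add: sum_distrib_right)
  qed
qed

text \<open>\<open>g / M\<close> competes in the supremum \<open>\<theta>\<close>, and undoing the
  scaling brings in the factor \<open>M\<close>.\<close>

lemma cgrad_compose_le_of_theta:
  assumes \<theta>: "ereal (cmod (\<psi> z)) * \<theta> \<phi> z < ereal \<epsilon>" and z: "z \<in> ball 0 1"
    and g: "g \<in> H_inf" "\<And>w. w \<in> ball 0 1 \<Longrightarrow> cmod (g w) \<le> M" and M: "M > 0"
  shows "cmod (\<psi> z) * cmod (cgrad (g \<circ> \<phi>) z u) \<le> M * \<epsilon> * bergman_norm z u"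
proof (cases "\<psi> z = 0")
  \<comment> \<open>Whatever the value of the supremum, even infinite a priori, its product with 0
    in \<open>ereal\<close> is 0; the hypothesis thus still yields
    \<open>\<epsilon> > 0\<close>.\<close>
  case True
  then have "\<epsilon> > 0" using \<theta> by (simp add: zero_ereal_def[symmetric])
  then show ?thesis using True M bergman_norm_nonneg[OF z] by simp
next
  case False
  then have p: "cmod (\<psi> z) > 0" by simp
  note hol = H_inf_imp_holo_on[OF g(1)]
  define h where "h = restrict (\<lambda>w. of_real (1 / M) * g w) (ball 0 1)"
  have h: "h \<in> H_inf" "sup_norm h \<le> 1"
  proof -
    have "cmod (of_real (1 / M) * g w) \<le> 1" if "w \<in> ball 0 1" for w
      using g(2)[OF that] M by (simp add: norm_mult norm_divide)
    note * = restrict_in_H_inf[OF holo_on_mult[OF holo_on_const hol] this]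
    show "h \<in> H_inf" "sup_norm h \<le> 1" unfolding h_def by (rule *, assumption)+
  qed
  have "Q (h \<circ> \<phi>) z \<le> \<theta> \<phi> z"
    unfolding \<theta>_def by (rule SUP_upper) (use h in auto)
  also have "\<theta> \<phi> z \<le> ereal (\<epsilon> / cmod (\<psi> z))"
    using \<theta> p by (cases "\<theta> \<phi> z") (auto simp: field_simps)
  finally have *: "cmod (cgrad (h \<circ> \<phi>) z u) \<le> \<epsilon> / cmod (\<psi> z) * bergman_norm z u"
    using Q_le_iff[OF z] by blast
  have "cgrad (h \<circ> \<phi>) z = cgrad (\<lambda>w. of_real (1 / M) * (g \<circ> \<phi>) w) z"
    by (rule cgrad_cong_open[OF open_ball z]) (use \<phi>_in_ball in \<open>auto simp: h_def\<close>)
  then have "cgrad (h \<circ> \<phi>) z u = of_real (1 / M) * cgrad (g \<circ> \<phi>) z u"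
    using cgrad_mult[OF holo_on_const holo_on_compose_\<phi>[OF hol] z, of "of_real (1 / M)" u] by simp
  then have "cmod (cgrad (g \<circ> \<phi>) z u) = M * cmod (cgrad (h \<circ> \<phi>) z u)"
    using M by (simp add: norm_mult norm_divide)
  also have "cmod (\<psi> z) * \<dots> \<le> cmod (\<psi> z) * (M * (\<epsilon> / cmod (\<psi> z) * bergman_norm z u))"
    using * M by (intro mult_left_mono) auto
  also have "\<dots> = M * \<epsilon> * bergman_norm z u" using p by simp
  finally show ?thesis by simp
qed

text \<open>The threshold \<open>r\<close> separating points mapped near the sphere from the others
  is fixed before the index \<open>n\<close>, so smallness of \<open>g n\<close> on a single compact
  ball serves all the other points at once.\<close>

lemma bloch_norm_wcomp_null_sequence:
  assumes W: "wcomp \<psi> \<phi> ` H_inf \<subseteq> bloch_space"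
    and van_\<psi>: "vanishes_at_boundary \<phi> (Q \<psi>)"
    and van_\<theta>: "vanishes_at_boundary \<phi> (\<lambda>z. ereal (cmod (\<psi> z)) * \<theta> \<phi> z)"
    and g: "\<And>n. g n \<in> H_inf" "\<And>n w. w \<in> ball 0 1 \<Longrightarrow> cmod (g n w) \<le> M"
    and lim: "\<And>\<rho>. \<rho> < 1 \<Longrightarrow> uniform_limit (cball 0 \<rho>) g (\<lambda>_. 0) sequentially"
    and e: "e > 0"
  shows "\<forall>\<^sub>F n in sequentially. bloch_norm (wcomp \<psi> \<phi> (g n)) \<le> ereal e"
proof -
  define N where "N = \<bar>M\<bar> + 1"
  have N: "N > 0" by (simp add: N_def)
  have gN: "cmod (g n w) \<le> N" if "w \<in> ball 0 1" for n w
    using g(2)[OF that, of n] by (auto simp: N_def)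
  \<comment> \<open>Near the sphere each of the two terms of the product rule is at most
    \<open>N * \<epsilon> = e / 4\<close> times the Bergman length; the seminorm thus takes half of
    \<open>e\<close> and the value at 0 the other half.\<close>
  define \<epsilon> where "\<epsilon> = e / (4 * N)"
  have \<epsilon>: "\<epsilon> > 0" using e N by (simp add: \<epsilon>_def)
  obtain A B where A: "0 \<le> A" and B: "0 \<le> B" and
    A\<psi>: "\<And>z u. z \<in> ball 0 1 \<Longrightarrow> cmod (cgrad \<psi> z u) \<le> A * bergman_norm z u" and
    B\<psi>: "\<And>z u. z \<in> ball 0 1 \<Longrightarrow>
      cmod (\<psi> z) * norm (\<chi> j. cgrad (\<lambda>x. \<phi> x $ j) z u) \<le> B * bergman_norm z u"
    using bounded_wcomp_symbol_bounds[OF W] by blast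
  obtain r1 where r1: "r1 < 1" "\<And>z. z \<in> ball 0 1 \<Longrightarrow> norm (\<phi> z) > r1 \<Longrightarrow> \<bar>Q \<psi> z\<bar> < ereal \<epsilon>"
    using van_\<psi> \<epsilon> unfolding vanishes_at_boundary_def by fastforce
  obtain r2 where r2: "r2 < 1" "\<And>z. z \<in> ball 0 1 \<Longrightarrow> norm (\<phi> z) > r2 \<Longrightarrow>
      \<bar>ereal (cmod (\<psi> z)) * \<theta> \<phi> z\<bar> < ereal \<epsilon>"
    using van_\<theta> \<epsilon> unfolding vanishes_at_boundary_def by fastforce
  \<comment> \<open>Including \<open>norm (\<phi> 0)\<close> puts \<open>\<phi> 0\<close> in the
    region where \<open>g n\<close> is small, which controls the value at the origin.\<close>
  define r where "r = max (max r1 r2) (norm (\<phi> 0))"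
  have r: "r < 1" "r1 \<le> r" "r2 \<le> r" "norm (\<phi> 0) \<le> r"
    using r1(1) r2(1) \<phi>_in_ball[of 0] by (auto simp: r_def)
  have abs_ub: "x < y" if "\<bar>x\<bar> < y" for x y :: ereal
    using that by (cases x; cases y) auto
  \<comment> \<open>Half the gap to the sphere: when \<open>norm (\<phi> z)\<close> is at most
    \<open>r\<close>, a Cauchy estimate of radius \<open>\<delta>\<close> about
    \<open>\<phi> z\<close> only sees \<open>cball 0 (r + \<delta>)\<close>, which is still inside
    the open ball.\<close>
  define \<delta> where "\<delta> = (1 - r) / 2"
  have \<delta>: "\<delta> > 0" "r + \<delta> < 1" using r by (auto simp: \<delta>_def field_simps)
  \<comment> \<open>\<open>A\<close> accounts for the gradient of \<open>\<psi>\<close>,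
    \<open>B / \<delta>\<close> for the Cauchy estimate, \<open>cmod (\<psi> 0)\<close> for the
    value at the origin, and 1 makes \<open>K\<close> positive.\<close>
  define K where "K = A + B / \<delta> + cmod (\<psi> 0) + 1"
  have K: "K > 0" using A B \<delta> by (simp add: K_def add_nonneg_pos)
  define \<eta> where "\<eta> = e / (2 * K)"
  have \<eta>: "\<eta> > 0" using e K by (simp add: \<eta>_def)
  have \<eta>K: "\<eta> * K = e / 2" using K by (simp add: \<eta>_def)
  have "\<forall>\<^sub>F n in sequentially. \<forall>x\<in>cball 0 (r + \<delta>). dist (g n x) 0 < \<eta>"
    using lim[OF \<delta>(2)] \<eta> unfolding uniform_limit_iff by blast
  then show ?thesis
  proof eventually_elim
    case (elim n)
    then have small: "cmod (g n x) \<le> \<eta>" if "norm x \<le> r + \<delta>" for x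
      using that by (simp add: less_imp_le)
    note hol = H_inf_imp_holo_on[OF g(1)[of n]]
    show ?case
    proof (rule bloch_norm_leI)
      show "cmod (wcomp \<psi> \<phi> (g n) 0) \<le> e / 2"
      proof -
        have "cmod (wcomp \<psi> \<phi> (g n) 0) = cmod (\<psi> 0) * cmod (g n (\<phi> 0))"
          by (simp add: wcomp_apply norm_mult)
        also have "\<dots> \<le> K * \<eta>"
          using A B \<delta> K r \<eta> by (intro mult_mono small) (auto simp: K_def)
        finally show ?thesis using \<eta>K by (simp add: mult.commute)
      qed
      show "e / 2 + e / 2 \<le> e" by simp
      fix z u :: "complex^'n" assume z: "z \<in> ball 0 1"
      note nn = bergman_norm_nonneg[OF z, of u]
      have split: "cmod (cgrad (wcomp \<psi> \<phi> (g n)) z u) \<le>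
          cmod (g n (\<phi> z)) * cmod (cgrad \<psi> z u) + cmod (\<psi> z) * cmod (cgrad (g n \<circ> \<phi>) z u)"
        unfolding cgrad_wcomp[OF hol z] norm_mult[symmetric] by (rule norm_triangle_ineq)
      show "cmod (cgrad (wcomp \<psi> \<phi> (g n)) z u) \<le> e / 2 * bergman_norm z u"
      proof (cases "norm (\<phi> z) > r")
        case True
        have "Q \<psi> z \<le> ereal \<epsilon>"
          using r1(2)[OF z] True r abs_ub less_imp_le by (meson le_less_trans)
        then have "cmod (cgrad \<psi> z u) \<le> \<epsilon> * bergman_norm z u"
          using Q_le_iff[OF z] by blast
        then have "cmod (g n (\<phi> z)) * cmod (cgrad \<psi> z u) \<le> N * (\<epsilon> * bergman_norm z u)"
          using N by (intro mult_mono gN \<phi>_in_ball z) auto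
        moreover have "cmod (\<psi> z) * cmod (cgrad (g n \<circ> \<phi>) z u) \<le> N * \<epsilon> * bergman_norm z u"
          by (rule cgrad_compose_le_of_theta[OF abs_ub[OF r2(2)[OF z]] z g(1) gN N]) (use True r in auto)
        moreover have "N * \<epsilon> = e / 4" using N by (simp add: \<epsilon>_def)
        ultimately show ?thesis using split by (simp add: mult.assoc[symmetric])
      next
        case False
        have "cmod (cgrad (g n \<circ> \<phi>) z u) \<le> \<eta> / \<delta> * norm (\<chi> j. cgrad (\<lambda>x. \<phi> x $ j) z u)"
          unfolding cgrad_compose_\<phi>[OF hol z]
        proof (rule Cauchy_estimate_cgrad[OF hol _ \<delta>(1)])
          have *: "norm x \<le> r + \<delta>" if "x \<in> cball (\<phi> z) \<delta>" for x
            using that False norm_triangle_ineq2[of x "\<phi> z"] by (simp add: dist_norm norm_minus_commute)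
          show "cball (\<phi> z) \<delta> \<subseteq> ball 0 1"
          proof
            show "x \<in> ball 0 1" if "x \<in> cball (\<phi> z) \<delta>" for x using *[OF that] \<delta> by simp
          qed
          show "cmod (g n x) \<le> \<eta>" if "x \<in> cball (\<phi> z) \<delta>" for x
            using small *[OF that] by blast
        qed
        then have "cmod (\<psi> z) * cmod (cgrad (g n \<circ> \<phi>) z u) \<le>
            cmod (\<psi> z) * (\<eta> / \<delta> * norm (\<chi> j. cgrad (\<lambda>x. \<phi> x $ j) z u))"
          by (rule mult_left_mono) simp
        also have "\<dots> = \<eta> / \<delta> * (cmod (\<psi> z) * norm (\<chi> j. cgrad (\<lambda>x. \<phi> x $ j) z u))"
          by simp
        also have "\<dots> \<le> \<eta> / \<delta> * (B * bergman_norm z u)"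
          using \<eta> \<delta> by (intro mult_left_mono B\<psi> z) auto
        finally have 1: "cmod (\<psi> z) * cmod (cgrad (g n \<circ> \<phi>) z u) \<le> \<eta> * (B / \<delta>) * bergman_norm z u"
          by simp
        have "cmod (g n (\<phi> z)) * cmod (cgrad \<psi> z u) \<le> \<eta> * (A * bergman_norm z u)"
          using False \<delta> \<eta> by (intro mult_mono small A\<psi> z) auto
        then have "cmod (cgrad (wcomp \<psi> \<phi> (g n)) z u) \<le> \<eta> * (A + B / \<delta>) * bergman_norm z u"
          using split 1 by (simp add: algebra_simps)
        also have "\<dots> \<le> \<eta> * K * bergman_norm z u"
          using \<eta> nn by (intro mult_right_mono mult_left_mono) (auto simp: K_def)
        finally show ?thesis by (simp add: \<eta>K)
      qed
    qed
  qed
qed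

end

subsection \<open>Test functions and compactness\<close>

text \<open>The Drury-Arveson kernel \<open>1 / (1 - herm w a)\<close>, normalised to be 1 at
  \<open>w = a\<close>; this is the function \<open>p\<close> of the overview. It is holomorphic in
  \<open>w\<close> because \<open>herm\<close> is complex linear in its first argument.\<close>

definition ball_kernel :: "complex^'n \<Rightarrow> complex^'n \<Rightarrow> complex" where
  "ball_kernel a w = of_real (1 - (norm a)\<^sup>2) / (1 - herm w a)"

lemma ball_kernel_self:
  assumes "norm a < 1"
  shows "ball_kernel a a = 1"
proof -
  have "(norm a)\<^sup>2 < 1" using assms by (simp add: power_less_one_iff abs_square_less_1)
  then have "1 - (norm a)\<^sup>2 \<noteq> 0" by simp
  then have "complex_of_real (1 - (norm a)\<^sup>2) \<noteq> 0" by (simp only: of_real_eq_0_iff simp_thms)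
  then show ?thesis by (simp add: ball_kernel_def herm_self)
qed

lemma norm_one_minus_herm_ge: "1 - norm w * norm a \<le> cmod (1 - herm w a)"
  using norm_triangle_ineq2[of 1 "herm w a"] norm_herm_le[of w a] by simp

lemma one_minus_herm_nonzero:
  assumes "norm w < 1" "norm a < 1"
  shows "1 - herm w a \<noteq> 0"
proof -
  have "norm w * norm a < 1" using assms mult_strict_mono[of "norm w" 1 "norm a" 1] by simp
  then show ?thesis using norm_one_minus_herm_ge[of w a] by auto
qed

lemma holo_on_ball_kernel:
  fixes a :: "complex^'n"
  assumes "norm a < 1"
  shows "holo_on (ball_kernel a) (ball 0 1)"
proof -
  have "bounded_linear (\<lambda>w. herm w a)"
    unfolding herm_def
    by (intro bounded_linear_sum bounded_linear_mult_const bounded_linear_vec_nth)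
  then have "holo_on (\<lambda>w. herm w a) (ball 0 1)"
    by (intro holo_onI[where D = "\<lambda>_ u. herm u a"] bounded_linear_imp_has_derivative)
       (simp_all add: herm_def sum_distrib_left mult_ac)
  then have "holo_on (\<lambda>w. of_real (1 - (norm a)\<^sup>2) * inverse (1 - herm w a)) (ball 0 1)"
    using one_minus_herm_nonzero[OF _ assms]
    by (intro holo_on_mult holo_on_const holo_on_inverse holo_on_diff) auto
  then show ?thesis by (simp add: ball_kernel_def[abs_def] divide_inverse)
qed

text \<open>The denominator is at least \<open>1 - norm a\<close> and at least
  \<open>1 - norm w\<close>. The first gives a bound uniform in both points, the second one that
  tends to 0 for fixed \<open>w\<close> as \<open>norm a\<close> tends to 1.\<close>

lemma ball_kernel_bounds:
  assumes a: "norm a < 1" and w: "norm w < 1"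
  shows "cmod (ball_kernel a w) \<le> 2" "cmod (ball_kernel a w) \<le> (1 - (norm a)\<^sup>2) / (1 - norm w)"
proof -
  have a2: "(norm a)\<^sup>2 < 1" using a by (simp add: power_less_one_iff abs_square_less_1)
  have n: "cmod (ball_kernel a w) = (1 - (norm a)\<^sup>2) / cmod (1 - herm w a)"
    using a2 by (simp only: ball_kernel_def norm_divide norm_of_real)
  have le: "norm w * norm a \<le> norm w" "norm w * norm a \<le> norm a"
    using mult_left_mono[of "norm a" 1 "norm w"] mult_right_mono[of "norm w" 1 "norm a"] a w by simp_all
  have "cmod (1 - herm w a) \<ge> 1 - norm a" "cmod (1 - herm w a) \<ge> 1 - norm w"
    using norm_one_minus_herm_ge[of w a] le by linarith+
  then have "cmod (ball_kernel a w) \<le> (1 - (norm a)\<^sup>2) / (1 - norm a)"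
    and 2: "cmod (ball_kernel a w) \<le> (1 - (norm a)\<^sup>2) / (1 - norm w)"
    unfolding n using a a2 w by (auto intro!: divide_left_mono mult_pos_pos)
  moreover have "(1 - (norm a)\<^sup>2) / (1 - norm a) = 1 + norm a"
    using a by (simp add: field_simps power2_eq_square)
  ultimately show "cmod (ball_kernel a w) \<le> 2" using a by simp
  show "cmod (ball_kernel a w) \<le> (1 - (norm a)\<^sup>2) / (1 - norm w)" by (rule 2)
qed

lemma ball_kernel_tendsto_0:
  assumes "\<And>n. norm (a n) < 1" "(\<lambda>n. norm (a n)) \<longlonglongrightarrow> 1" "norm w < 1"
  shows "(\<lambda>n. ball_kernel (a n) w) \<longlonglongrightarrow> 0"
proof (rule Lim_null_comparison)
  show "\<forall>\<^sub>F n in sequentially. cmod (ball_kernel (a n) w) \<le> (1 - (norm (a n))\<^sup>2) / (1 - norm w)"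
    using ball_kernel_bounds(2)[OF assms(1,3)] by simp
  have "(\<lambda>n. (1 - (norm (a n))\<^sup>2) / (1 - norm w)) \<longlonglongrightarrow> (1 - 1\<^sup>2) / (1 - norm w)"
    by (intro tendsto_intros assms(2)) (use assms(3) in auto)
  then show "(\<lambda>n. (1 - (norm (a n))\<^sup>2) / (1 - norm w)) \<longlonglongrightarrow> 0" by simp
qed

lemma not_vanishes_at_boundary_sequence:
  assumes "\<not> vanishes_at_boundary \<phi> F" "\<And>z. z \<in> ball 0 1 \<Longrightarrow> norm (\<phi> z) < 1"
  obtains \<epsilon> z where "\<epsilon> > 0" "\<And>n. z n \<in> ball 0 1" "(\<lambda>n. norm (\<phi> (z n))) \<longlonglongrightarrow> 1"
    "\<And>n :: nat. ereal \<epsilon> \<le> \<bar>F (z n)\<bar>"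
proof -
  obtain \<epsilon> where \<epsilon>: "\<epsilon> > 0" and
    far: "\<And>r. r \<in> {0<..<1} \<Longrightarrow> \<exists>z\<in>ball 0 1. norm (\<phi> z) > r \<and> ereal \<epsilon> \<le> \<bar>F z\<bar>"
    using assms(1) unfolding vanishes_at_boundary_def by (meson not_less)
  \<comment> \<open>The offset 2 gives \<open>r 0 = 1 / 2\<close>; an offset of 1 would give 0,
    outside the open interval of admissible radii.\<close>
  define r where "r = (\<lambda>n::nat. 1 - 1 / (real n + 2))"
  have "\<exists>z\<in>ball 0 1. norm (\<phi> z) > r n \<and> ereal \<epsilon> \<le> \<bar>F z\<bar>" for n
    by (rule far) (simp add: r_def)
  then obtain z where z: "\<And>n. z n \<in> ball 0 1" "\<And>n. norm (\<phi> (z n)) > r n"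
      "\<And>n. ereal \<epsilon> \<le> \<bar>F (z n)\<bar>" by metis
  have "r \<longlonglongrightarrow> 1" unfolding r_def by real_asymp
  have "(\<lambda>n. norm (\<phi> (z n))) \<longlonglongrightarrow> 1"
    by (rule real_tendsto_sandwich[OF _ _ \<open>r \<longlonglongrightarrow> 1\<close> tendsto_const])
       (use z assms(2) in \<open>auto intro!: always_eventually less_imp_le\<close>)
  then show ?thesis using that \<epsilon> z by blast
qed

section \<open>Sufficiency, followed by the three necessary conditions\<close>

context weighted_composition
begin

lemma norm_\<phi>_less_1: "z \<in> ball 0 1 \<Longrightarrow> norm (\<phi> z) < 1"
  using \<phi>_in_ball by auto

text \<open>The limit of the images is the image of the Montel limit: by linearity the distance to
  it is the Bloch norm of the image of a bounded null sequence.\<close>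

lemma bounded_imp_compact:
  assumes W: "bounded_Hinf_bloch (wcomp \<psi> \<phi>)"
    and van: "vanishes_at_boundary \<phi> (Q \<psi>)"
      "vanishes_at_boundary \<phi> (\<lambda>z. ereal (cmod (\<psi> z)) * \<theta> \<phi> z)"
  shows "compact_Hinf_bloch (wcomp \<psi> \<phi>)"
  unfolding compact_Hinf_bloch_def
proof (intro conjI allI impI)
  show im: "wcomp \<psi> \<phi> ` H_inf \<subseteq> bloch_space" using W by (simp add: bounded_Hinf_bloch_def)
  fix S :: "(complex^'n \<Rightarrow> complex) set"
  assume S: "S \<subseteq> H_inf" and "\<exists>C. \<forall>f\<in>S. sup_norm f \<le> C"
  then obtain C where C: "\<And>f. f \<in> S \<Longrightarrow> sup_norm f \<le> C" by blast
  have TS: "wcomp \<psi> \<phi> ` S \<subseteq> bloch_space" using im S by blast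
  show "compactin bloch_topology (bloch_topology closure_of (wcomp \<psi> \<phi> ` S))"
    unfolding compactin_bloch_closure_iff[OF TS]
  proof (intro allI impI)
    fix \<sigma> :: "nat \<Rightarrow> complex^'n \<Rightarrow> complex" assume "range \<sigma> \<subseteq> wcomp \<psi> \<phi> ` S"
    then have "\<forall>n. \<exists>f\<in>S. \<sigma> n = wcomp \<psi> \<phi> f" by blast
    then obtain f where f: "\<And>n. f n \<in> S" and \<sigma>: "\<And>n. \<sigma> n = wcomp \<psi> \<phi> (f n)" by metis
    have fH: "f n \<in> H_inf" for n using f S by blast
    have fC: "cmod (f n w) \<le> C" if "w \<in> ball 0 1" for n w
      using norm_le_sup_norm[OF fH that] C[OF f] by (rule order_trans)
    obtain g r where r: "strict_mono r" and g: "holo_on g (ball 0 1)" "\<And>x. x \<in> ball 0 1 \<Longrightarrow> cmod (g x) \<le> C"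
      and lim: "\<And>\<rho>. \<rho> < 1 \<Longrightarrow> uniform_limit (cball 0 \<rho>) (\<lambda>n. f (r n)) g sequentially"
      by (rule Montel_ball[OF H_inf_imp_holo_on[OF fH] fC], assumption) (rule that)
    define l where "l = wcomp \<psi> \<phi> (restrict g (ball 0 1))"
    have l: "l \<in> bloch_space"
      unfolding l_def using im restrict_in_H_inf(1)[OF g] by blast
    define d where "d = (\<lambda>n. restrict (\<lambda>w. f (r n) w - g w) (ball 0 1))"
    have d_le: "cmod (f (r n) w - g w) \<le> 2 * C" if "w \<in> ball 0 1" for n w
      using norm_triangle_ineq4[of "f (r n) w" "g w"] fC[OF that, of "r n"] g(2)[OF that] by simp
    have d: "d n \<in> H_inf" for n
      unfolding d_def
      by (rule restrict_in_H_inf[OF holo_on_diff[OF H_inf_imp_holo_on[OF fH] g(1)] d_le])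
    have d_lim: "uniform_limit (cball 0 \<rho>) d (\<lambda>_. 0) sequentially" if "\<rho> < 1" for \<rho>
      using lim[OF that] that by (fastforce simp: uniform_limit_iff d_def dist_norm elim!: eventually_mono)
    have dist: "bloch_norm (wcomp \<psi> \<phi> (d n)) = ereal (bloch_dist (\<sigma> (r n)) l)" for n
    proof -
      have "\<sigma> (r n) \<in> bloch_space" using \<sigma> f TS by auto
      then have "ereal (bloch_dist (\<sigma> (r n)) l) = bloch_norm (\<lambda>z. \<sigma> (r n) z - l z)"
        using bloch_norm_diff_finite l by metis
      also have "\<dots> = bloch_norm (wcomp \<psi> \<phi> (d n))"
        by (rule bloch_norm_cong)
           (use \<phi>_in_ball in \<open>auto simp: \<sigma> l_def d_def wcomp_apply right_diff_distrib\<close>)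
      finally show ?thesis by simp
    qed
    have dist_nonneg: "0 \<le> bloch_dist (\<sigma> (r n)) l" for n
      by (rule Metric_space.nonneg[OF Metric_space_bloch])
    have "(\<lambda>n. bloch_dist (\<sigma> (r n)) l) \<longlonglongrightarrow> 0"
    proof (rule tendstoI)
      fix e :: real assume "e > 0"
      then have "\<forall>\<^sub>F n in sequentially. bloch_norm (wcomp \<psi> \<phi> (d n)) \<le> ereal (e / 2)"
        by (intro bloch_norm_wcomp_null_sequence[OF im van d _ d_lim, of "2 * C"])
           (use d_le in \<open>auto simp: d_def\<close>)
      then show "\<forall>\<^sub>F n in sequentially. dist (bloch_dist (\<sigma> (r n)) l) 0 < e"
        by (rule eventually_mono)
           (use \<open>e > 0\<close> dist_nonneg in \<open>simp add: dist abs_of_nonneg\<close>)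
    qed
    then show "\<exists>l\<in>bloch_space. \<exists>r. strict_mono r \<and> (\<lambda>n. bloch_dist (\<sigma> (r n)) l) \<longlonglongrightarrow> 0"
      using l r by blast
  qed
qed

text \<open>A relatively compact set is metrically bounded. The image of the unit ball contains the
  image of 0, so bounded distances become bounded norms, and scaling does the rest.\<close>

lemma compact_imp_bounded:
  assumes "compact_Hinf_bloch (wcomp \<psi> \<phi>)"
  shows "bounded_Hinf_bloch (wcomp \<psi> \<phi>)"
proof -
  have im: "wcomp \<psi> \<phi> ` H_inf \<subseteq> bloch_space" using assms by (simp add: compact_Hinf_bloch_def)
  interpret Metric_space "bloch_space :: (complex^'n \<Rightarrow> complex) set" bloch_dist
    by (rule Metric_space_bloch)
  define S where "S = {f \<in> (H_inf :: (complex^'n \<Rightarrow> complex) set). sup_norm f \<le> 1}"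
  have TS: "wcomp \<psi> \<phi> ` S \<subseteq> bloch_space" using im by (auto simp: S_def)
  have "S \<subseteq> H_inf" "\<exists>C. \<forall>f\<in>S. sup_norm f \<le> C" by (auto simp: S_def)
  then have "compactin bloch_topology (bloch_topology closure_of (wcomp \<psi> \<phi> ` S))"
    using assms unfolding compact_Hinf_bloch_def by blast
  then have "mbounded (wcomp \<psi> \<phi> ` S)"
    unfolding bloch_topology_def
    using compactin_imp_mbounded mbounded_closure_of_eq[OF TS] by blast
  then obtain B where B: "\<And>f g. f \<in> S \<Longrightarrow> g \<in> S \<Longrightarrow> bloch_dist (wcomp \<psi> \<phi> f) (wcomp \<psi> \<phi> g) \<le> B"
    unfolding mbounded_alt by blast
  define o0 where "o0 = restrict (\<lambda>w :: complex^'n. 0 :: complex) (ball 0 1)"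
  have o0: "o0 \<in> S"
    unfolding o0_def S_def using restrict_in_H_inf[of "\<lambda>_. 0" 1] by (auto simp: holo_on_const)
  have B': "bloch_norm (wcomp \<psi> \<phi> f) \<le> ereal B" if "f \<in> S" for f
  proof -
    have "bloch_norm (wcomp \<psi> \<phi> f) = bloch_norm (\<lambda>z. wcomp \<psi> \<phi> f z - wcomp \<psi> \<phi> o0 z)"
      by (rule bloch_norm_cong) (use \<phi>_in_ball in \<open>auto simp: wcomp_apply o0_def\<close>)
    also have "\<dots> = ereal (bloch_dist (wcomp \<psi> \<phi> f) (wcomp \<psi> \<phi> o0))"
      using TS o0 that by (intro bloch_norm_diff_finite) auto
    finally show ?thesis using B[OF that o0] by simp
  qed
  have "bloch_norm (wcomp \<psi> \<phi> f) \<le> ereal (B * sup_norm f)" if f: "f \<in> H_inf" for f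
  proof -
    define s where "s = sup_norm f"
    have fs: "cmod (f w) \<le> s" if "w \<in> ball 0 1" for w
      unfolding s_def by (rule norm_le_sup_norm[OF f that])
    have s0: "s \<ge> 0" using order_trans[OF norm_ge_zero fs[of 0]] by simp
    \<comment> \<open>If \<open>s = 0\<close> then \<open>1 / s = 0\<close>, so \<open>h\<close>
      vanishes on the ball, as \<open>f\<close> does, and \<open>f w = of_real s * h w\<close>
      remains true.\<close>
    define h where "h = restrict (\<lambda>w. of_real (1 / s) * f w) (ball 0 1)"
    have "cmod (of_real (1 / s) * f w) \<le> 1" if "w \<in> ball 0 1" for w
      using fs[OF that] s0 by (cases "s = 0") (auto simp: norm_mult norm_divide)
    note h = restrict_in_H_inf[OF holo_on_mult[OF holo_on_const H_inf_imp_holo_on[OF f]] this]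
    have hS: "h \<in> S" unfolding h_def S_def using h by auto
    have "f w = of_real s * h w" if "w \<in> ball 0 1" for w
      using fs[OF that] that by (cases "s = 0") (auto simp: h_def)
    then have "bloch_norm (wcomp \<psi> \<phi> f) = bloch_norm (\<lambda>z. of_real s * wcomp \<psi> \<phi> h z)"
      by (intro bloch_norm_cong) (use \<phi>_in_ball in \<open>auto simp: wcomp_apply\<close>)
    also have "\<dots> \<le> ereal (cmod (of_real s) * B)"
      using hS by (intro bloch_norm_scale_le B' holo_on_wcomp H_inf_imp_holo_on) (auto simp: S_def)
    finally show ?thesis using s0 by (simp add: s_def mult.commute)
  qed
  then show ?thesis unfolding bounded_Hinf_bloch_def using im by blast
qed

text \<open>Some subsequence of the images converges in Bloch norm to \<open>l\<close>. Point
  evaluations are continuous and the images tend to 0 pointwise, so \<open>l\<close> is 0 on the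
  ball and the norms along the subsequence tend to 0. One such index is what the contradictions
  below call for.\<close>

lemma compact_null_sequence:
  assumes W: "compact_Hinf_bloch (wcomp \<psi> \<phi>)"
    and f: "\<And>n. f n \<in> H_inf" "\<And>n. sup_norm (f n) \<le> C"
    and lim: "\<And>w. w \<in> ball 0 1 \<Longrightarrow> (\<lambda>n. f n w) \<longlonglongrightarrow> 0"
    and e: "e > 0"
  shows "\<exists>n. bloch_norm (wcomp \<psi> \<phi> (f n)) \<le> ereal e"
proof -
  have TS: "wcomp \<psi> \<phi> ` range f \<subseteq> bloch_space"
    using W f(1) unfolding compact_Hinf_bloch_def by blast
  have "compactin bloch_topology (bloch_topology closure_of (wcomp \<psi> \<phi> ` range f))"
    using W f unfolding compact_Hinf_bloch_def by (metis image_subset_iff rangeE)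
  from this[unfolded compactin_bloch_closure_iff[OF TS], rule_format, of "\<lambda>n. wcomp \<psi> \<phi> (f n)"]
  obtain l r where l: "l \<in> bloch_space" and r: "strict_mono r"
    and dist: "(\<lambda>n. bloch_dist (wcomp \<psi> \<phi> (f (r n))) l) \<longlonglongrightarrow> 0" by blast
  have norm_eq: "bloch_norm (\<lambda>z. wcomp \<psi> \<phi> (f (r n)) z - l z) =
      ereal (bloch_dist (wcomp \<psi> \<phi> (f (r n))) l)" for n
    using TS l by (intro bloch_norm_diff_finite) auto
  have l0: "l w = 0" if w: "w \<in> ball 0 1" for w
  proof -
    define K where "K = 1 + sqrt ((real CARD('n) + 1) / 2) / (1 - (norm w)\<^sup>2)"
    have "(\<lambda>n. wcomp \<psi> \<phi> (f (r n)) w - l w) \<longlonglongrightarrow> 0"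
    proof (rule Lim_null_comparison)
      show "\<forall>\<^sub>F n in sequentially.
          cmod (wcomp \<psi> \<phi> (f (r n)) w - l w) \<le> K * bloch_dist (wcomp \<psi> \<phi> (f (r n))) l"
        unfolding K_def using l w f(1) norm_eq
        by (intro always_eventually allI bloch_norm_pointwise_bound holo_on_diff holo_on_wcomp)
           (auto simp: bloch_space_def H_ball_def H_inf_def)
      show "(\<lambda>n. K * bloch_dist (wcomp \<psi> \<phi> (f (r n))) l) \<longlonglongrightarrow> 0"
        using tendsto_mult_right_zero[OF dist] .
    qed
    moreover have "(\<lambda>n. wcomp \<psi> \<phi> (f (r n)) w - l w) \<longlonglongrightarrow> \<psi> w * 0 - l w"
      using LIMSEQ_subseq_LIMSEQ[OF lim[OF \<phi>_in_ball[OF w]] r]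
      by (simp only: wcomp_apply[OF w] o_def) (intro tendsto_intros)
    ultimately show ?thesis using LIMSEQ_unique by fastforce
  qed
  have "\<forall>\<^sub>F n in sequentially. bloch_dist (wcomp \<psi> \<phi> (f (r n))) l < e"
    using dist e by (rule order_tendstoD)
  then obtain n where n: "bloch_dist (wcomp \<psi> \<phi> (f (r n))) l < e"
    by (auto simp: eventually_sequentially)
  have "bloch_norm (wcomp \<psi> \<phi> (f (r n))) = bloch_norm (\<lambda>z. wcomp \<psi> \<phi> (f (r n)) z - l z)"
    by (rule bloch_norm_cong) (simp add: l0)
  also have "\<dots> \<le> ereal e" using n by (simp add: norm_eq)
  finally show ?thesis by blast
qed

text \<open>At \<open>z n\<close> the gradient of the image of the test function is that of
  \<open>\<psi>\<close>, so one image of small Bloch norm contradicts the lower bound on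
  \<open>Q \<psi>\<close> along the sequence.\<close>

lemma compact_imp_Q_vanishes:
  assumes W: "compact_Hinf_bloch (wcomp \<psi> \<phi>)"
  shows "vanishes_at_boundary \<phi> (Q \<psi>)"
proof (rule ccontr)
  assume nv: "\<not> ?thesis"
  obtain \<epsilon> z where \<epsilon>: "\<epsilon> > 0" and z: "\<And>n. z n \<in> ball 0 1"
    and lim: "(\<lambda>n. norm (\<phi> (z n))) \<longlonglongrightarrow> 1" and ge: "\<And>n :: nat. ereal \<epsilon> \<le> \<bar>Q \<psi> (z n)\<bar>"
    by (rule not_vanishes_at_boundary_sequence[OF nv norm_\<phi>_less_1], assumption) (rule that)
  note a = norm_\<phi>_less_1[OF z]
  \<comment> \<open>\<open>1 - (1 - p)\<^sup>2\<close> has value 1 and gradient 0 where \<open>p = 1\<close>.\<close>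
  define q where "q = (\<lambda>n w. ball_kernel (\<phi> (z n)) w * (2 - ball_kernel (\<phi> (z n)) w))"
  note kernel = holo_on_ball_kernel[OF a]
  have q: "holo_on (q n) (ball 0 1)" for n
    unfolding q_def by (intro holo_on_mult holo_on_diff holo_on_const kernel)
  have q8: "cmod (q n w) \<le> 2 * (2 + 2)" if "w \<in> ball 0 1" for n w
  proof -
    have "cmod (ball_kernel (\<phi> (z n)) w) \<le> 2" using that by (intro ball_kernel_bounds a) simp
    moreover from this have "cmod (2 - ball_kernel (\<phi> (z n)) w) \<le> 2 + 2"
      using norm_triangle_ineq4[of 2 "ball_kernel (\<phi> (z n)) w"] by simp
    ultimately show ?thesis unfolding q_def norm_mult by (intro mult_mono) auto
  qed
  define f where "f = (\<lambda>n. restrict (q n) (ball 0 1))"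
  have f: "f n \<in> H_inf" "sup_norm (f n) \<le> 2 * (2 + 2)" for n
    unfolding f_def using restrict_in_H_inf[OF q q8] by auto
  have "(\<lambda>n. f n w) \<longlonglongrightarrow> 0" if "w \<in> ball 0 1" for w
  proof -
    have "(\<lambda>n. q n w) \<longlonglongrightarrow> 0 * (2 - 0)"
      unfolding q_def using that by (intro tendsto_intros ball_kernel_tendsto_0 a lim) simp_all
    then show ?thesis using that by (simp add: f_def)
  qed
  from compact_null_sequence[OF W f this, of "\<epsilon> / 2"] \<epsilon>
  obtain n where n: "bloch_norm (wcomp \<psi> \<phi> (f n)) \<le> ereal (\<epsilon> / 2)" by auto
  let ?a = "\<phi> (z n)"
  have aB: "?a \<in> ball 0 1" using a by simp
  have "cgrad (f n) ?a = cgrad (q n) ?a"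
    by (rule cgrad_cong_open[OF open_ball aB]) (simp add: f_def)
  moreover have "cgrad (q n) ?a u = 0" for u
    unfolding q_def
    by (simp add: cgrad_mult[OF kernel holo_on_diff[OF holo_on_const kernel] aB]
        cgrad_diff[OF holo_on_const kernel aB] ball_kernel_self[OF a])
  moreover have "f n ?a = 1" using aB by (simp add: f_def q_def ball_kernel_self[OF a])
  ultimately have "cgrad (wcomp \<psi> \<phi> (f n)) (z n) u = cgrad \<psi> (z n) u" for u
    by (simp add: cgrad_wcomp[OF H_inf_imp_holo_on[OF f(1)] z]
        cgrad_compose_\<phi>[OF H_inf_imp_holo_on[OF f(1)] z])
  then have "cmod (cgrad \<psi> (z n) u) \<le> \<epsilon> / 2 * bergman_norm (z n) u" for u
    using bloch_norm_leD(3)[OF n z[of n], of u] by simp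
  then have "Q \<psi> (z n) \<le> ereal (\<epsilon> / 2)" by (simp add: Q_le_iff[OF z])
  then show False using ge[of n] Q_nonneg[OF z, of \<psi> n] \<epsilon>
    by (cases "Q \<psi> (z n)") auto
qed

text \<open>The zero function competes in the supremum. This removes the absolute value that occurs
  in \<open>vanishes_at_boundary\<close>.\<close>

lemma \<theta>_nonneg:
  assumes "z \<in> ball 0 1"
  shows "0 \<le> \<theta> \<phi> z"
proof -
  define o0 where "o0 = restrict (\<lambda>w :: complex^'n. 0 :: complex) (ball 0 1)"
  have "o0 \<in> {f \<in> H_inf. sup_norm f \<le> 1}"
    unfolding o0_def using restrict_in_H_inf[of "\<lambda>_. 0" 1] by (auto simp: holo_on_const)
  then have "Q (o0 \<circ> \<phi>) z \<le> \<theta> \<phi> z" unfolding \<theta>_def by (rule SUP_upper)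
  then show ?thesis using Q_nonneg[OF assms] order_trans by blast
qed

text \<open>The test functions are built from near-extremal functions for \<open>\<theta>\<close>.
  These vary with \<open>n\<close> but share the bound 1, so the kernel factor alone forces
  pointwise convergence to 0.\<close>

lemma compact_imp_theta_vanishes:
  assumes W: "compact_Hinf_bloch (wcomp \<psi> \<phi>)"
  shows "vanishes_at_boundary \<phi> (\<lambda>z. ereal (cmod (\<psi> z)) * \<theta> \<phi> z)"
proof (rule ccontr)
  assume nv: "\<not> ?thesis"
  obtain \<epsilon> z where \<epsilon>: "\<epsilon> > 0" and z: "\<And>n. z n \<in> ball 0 1"
    and lim: "(\<lambda>n. norm (\<phi> (z n))) \<longlonglongrightarrow> 1"
    and ge: "\<And>n :: nat. ereal \<epsilon> \<le> \<bar>ereal (cmod (\<psi> (z n))) * \<theta> \<phi> (z n)\<bar>"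
    by (rule not_vanishes_at_boundary_sequence[OF nv norm_\<phi>_less_1], assumption) (rule that)
  note a = norm_\<phi>_less_1[OF z]
  \<comment> \<open>A zero of \<open>\<psi>\<close> would make the product 0 in \<open>ereal\<close>
    whatever \<open>\<theta>\<close> is, against the lower bound \<open>\<epsilon>\<close>.\<close>
  have \<psi>0: "cmod (\<psi> (z n)) > 0" for n
    using ge[of n] \<epsilon> by (cases "\<psi> (z n) = 0") (auto simp: zero_ereal_def[symmetric])
  \<comment> \<open>The supremum need not be attained. Halving \<open>\<epsilon>\<close> puts the
    level strictly below it, so some competitor exceeds the level, and \<open>\<epsilon> / 2\<close>
    is also the Bloch norm bound requested later.\<close>
  have "\<exists>h. h \<in> H_inf \<and> sup_norm h \<le> 1 \<and> ereal (\<epsilon> / 2 / cmod (\<psi> (z n))) < Q (h \<circ> \<phi>) (z n)" for n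
  proof -
    have "ereal (\<epsilon> / 2 / cmod (\<psi> (z n))) < \<theta> \<phi> (z n)"
      using ge[of n] \<theta>_nonneg[OF z, of n] \<psi>0[of n] \<epsilon>
      by (cases "\<theta> \<phi> (z n)") (auto simp: field_simps abs_mult)
    then show ?thesis unfolding \<theta>_def less_SUP_iff by blast
  qed
  then obtain h where h: "\<And>n. h n \<in> H_inf" "\<And>n. sup_norm (h n) \<le> 1"
    and hQ: "\<And>n. ereal (\<epsilon> / 2 / cmod (\<psi> (z n))) < Q (h n \<circ> \<phi>) (z n)" by metis
  have h1: "cmod (h n w) \<le> 1" if "w \<in> ball 0 1" for n w
    using norm_le_sup_norm[OF h(1) that] h(2) by (rule order_trans)
  note h_holo = H_inf_imp_holo_on[OF h(1)] and kernel = holo_on_ball_kernel[OF a]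
  define q where "q = (\<lambda>n w. (h n w - h n (\<phi> (z n))) * ball_kernel (\<phi> (z n)) w)"
  have q: "holo_on (q n) (ball 0 1)" for n
    unfolding q_def by (intro holo_on_mult holo_on_diff holo_on_const kernel h_holo)
  have h2: "cmod (h n w - h n (\<phi> (z n))) \<le> 2" if "w \<in> ball 0 1" for n w
    using norm_triangle_ineq4[of "h n w" "h n (\<phi> (z n))"] h1[OF that, of n] h1[OF \<phi>_in_ball[OF z], of n n]
    by simp
  have q_le: "cmod (q n w) \<le> 2 * cmod (ball_kernel (\<phi> (z n)) w)" if "w \<in> ball 0 1" for n w
    unfolding q_def norm_mult using h2[OF that] by (intro mult_right_mono) auto
  have q4: "cmod (q n w) \<le> 4" if "w \<in> ball 0 1" for n w
    using q_le[OF that, of n] ball_kernel_bounds(1)[OF a, of w n] that by simp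
  define f where "f = (\<lambda>n. restrict (q n) (ball 0 1))"
  have f: "f n \<in> H_inf" "sup_norm (f n) \<le> 4" for n
    unfolding f_def using restrict_in_H_inf[OF q q4] by auto
  have "(\<lambda>n. f n w) \<longlonglongrightarrow> 0" if w: "w \<in> ball 0 1" for w
  proof (rule Lim_null_comparison)
    show "\<forall>\<^sub>F n in sequentially. cmod (f n w) \<le> 2 * cmod (ball_kernel (\<phi> (z n)) w)"
      using q_le[OF w] w by (simp add: f_def)
    show "(\<lambda>n. 2 * cmod (ball_kernel (\<phi> (z n)) w)) \<longlonglongrightarrow> 0"
      using w by (intro tendsto_mult_right_zero tendsto_norm_zero ball_kernel_tendsto_0 a lim) simp_all
  qed
  from compact_null_sequence[OF W f this, of "\<epsilon> / 2"] \<epsilon>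
  obtain n where n: "bloch_norm (wcomp \<psi> \<phi> (f n)) \<le> ereal (\<epsilon> / 2)" by auto
  let ?a = "\<phi> (z n)"
  have aB: "?a \<in> ball 0 1" using a by simp
  have "cgrad (f n) ?a = cgrad (q n) ?a"
    by (rule cgrad_cong_open[OF open_ball aB]) (simp add: f_def)
  moreover have "cgrad (q n) ?a u = cgrad (h n) ?a u" for u
    unfolding q_def
    by (simp add: cgrad_mult[OF holo_on_diff[OF h_holo holo_on_const] kernel aB]
        cgrad_diff[OF h_holo holo_on_const aB] ball_kernel_self[OF a])
  moreover have "f n ?a = 0" using aB by (simp add: f_def q_def)
  ultimately have "cgrad (wcomp \<psi> \<phi> (f n)) (z n) u = \<psi> (z n) * cgrad (h n \<circ> \<phi>) (z n) u" for u
    by (simp add: cgrad_wcomp[OF H_inf_imp_holo_on[OF f(1)] z]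
        cgrad_compose_\<phi>[OF H_inf_imp_holo_on[OF f(1)] z] cgrad_compose_\<phi>[OF h_holo z])
  then have "cmod (\<psi> (z n)) * cmod (cgrad (h n \<circ> \<phi>) (z n) u) \<le> \<epsilon> / 2 * bergman_norm (z n) u" for u
    using bloch_norm_leD(3)[OF n z[of n], of u] by (simp add: norm_mult)
  then have "Q (h n \<circ> \<phi>) (z n) \<le> ereal (\<epsilon> / 2 / cmod (\<psi> (z n)))"
    using \<psi>0[of n] by (simp add: Q_le_iff[OF z] pos_le_divide_eq mult_ac)
  then show False using hQ[of n] by simp
qed

end

theorem theorem4p4:
  fixes \<phi> :: "complex^'n \<Rightarrow> complex^'n" and \<psi> :: "complex^'n \<Rightarrow> complex"
  assumes "holo_self_map \<phi>" and "holo_on \<psi> (ball 0 1)"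
  shows "compact_Hinf_bloch (wcomp \<psi> \<phi>) \<longleftrightarrow>
           bounded_Hinf_bloch (wcomp \<psi> \<phi>) \<and>
           vanishes_at_boundary \<phi> (Q \<psi>) \<and>
           vanishes_at_boundary \<phi> (\<lambda>z. ereal (cmod (\<psi> z)) * \<theta> \<phi> z)"
proof -
  interpret weighted_composition \<phi> \<psi> by unfold_locales (fact assms)+
  show ?thesis
    using bounded_imp_compact compact_imp_bounded compact_imp_Q_vanishes compact_imp_theta_vanishes
    by blast
qed

end
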